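(* Let $\tau$ be an elliptic function. Then there exists a periodic linear system $(-A,B,C;E)$, where $A,B,C$ and $E$ are infinite block diagonal matrices with $2\times2$ blocks, such that $$\frac{d}{dx}\log\tau(x)=\operatorname{trace}W(x,x).$$
   Context: Periodic linear system $(-A,B,C;E)$: let $A,B,C,E$ be square matrices of equal size and $\varepsilon=\pm1$, and suppose that $BC=\varepsilon(AE+EA)$, $BE=EB$, $EA=AE$ and $\exp 2\pi A=I$. One sets $$W(x,y)=Ce^{-xA}\bigl(I-e^{-xA}Ee^{-xA}\bigr)^{-1}e^{-yA}B .$$ The definition is stated for finite matrices; it is extended to infinite block diagonal matrices, and $\varepsilon$ may then be replaced by a diagonal matrix with blocks of $\pm1$ entries on the diagonal. An elliptic function is a function of rational character (meromorphic) on a complex torus $\mathbf{C}/(\omega_1\mathbf{Z}+\omega_2\mathbf{Z})$, with $\Im(\omega_2/\omega_1)>0$.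
   Formalization: Since exp 2πA = I forces W(x,x) to have period π, the claim fails as stated for lattices not containing π; it is proved for every elliptic τ in the rescaled variable, x ↦ τ(ω1 x/π) (τ itself if ω1 = π), wherever this function is analytic and nonzero. *)

theory Defs
  imports "HOL-Complex_Analysis.Complex_Analysis"
begin

subsection \<open>Periodic linear systems with finite matrices\<close>

text \<open>
  The class-level product and exponential are not those of matrices (the product of type
  \<open>vec\<close> is componentwise), so powers and the exponential series are taken here with respect
  to \<open>**\<close>.
\<close>

abbreviation mat_scale :: "complex \<Rightarrow> complex^'n^'n \<Rightarrow> complex^'n^'n" where
  "mat_scale c M \<equiv> map_matrix ((*) c) M"

primrec mat_power :: "complex^'n^'n \<Rightarrow> nat \<Rightarrow> complex^'n^'n" where
  "mat_power M 0 = mat 1"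
| "mat_power M (Suc k) = M ** mat_power M k"

definition mat_exp :: "complex^'n^'n \<Rightarrow> complex^'n^'n" where
  "mat_exp M = (\<Sum>k. (1 / fact k) *\<^sub>R mat_power M k)"

definition periodic_linear_system ::
  "real \<Rightarrow> complex^'n^'n \<Rightarrow> complex^'n^'n \<Rightarrow> complex^'n^'n \<Rightarrow> complex^'n^'n \<Rightarrow> bool" where
  "periodic_linear_system \<epsilon> A B C E \<longleftrightarrow>
     (\<epsilon> = 1 \<or> \<epsilon> = -1) \<and>
     B ** C = \<epsilon> *\<^sub>R (A ** E + E ** A) \<and>
     B ** E = E ** B \<and>
     E ** A = A ** E \<and>
     mat_exp (mat_scale (of_real (2 * pi)) A) = mat 1"

definition resolvent_matrix :: "complex^'n^'n \<Rightarrow> complex^'n^'n \<Rightarrow> complex \<Rightarrow> complex^'n^'n" where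
  "resolvent_matrix A E x =
     mat 1 - mat_exp (mat_scale (-x) A) ** E ** mat_exp (mat_scale (-x) A)"

definition W_fun ::
  "complex^'n^'n \<Rightarrow> complex^'n^'n \<Rightarrow> complex^'n^'n \<Rightarrow> complex^'n^'n \<Rightarrow> complex \<Rightarrow> complex \<Rightarrow> complex^'n^'n" where
  "W_fun A B C E x y =
     C ** mat_exp (mat_scale (-x) A) ** matrix_inv (resolvent_matrix A E x)
       ** mat_exp (mat_scale (-y) A) ** B"


subsection \<open>Infinite block diagonal matrices with two by two blocks\<close>

text \<open>
  An infinite block diagonal matrix is given by the sequence of its diagonal blocks; \<open>bd_entry\<close>
  lists the entries of the infinite matrix, whose rows and columns are indexed by pairs (block,
  position in the block). Sums, products, exponentials and inverses of such matrices are formed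
  blockwise. The diagonal matrix that replaces the sign \<open>\<epsilon>\<close> has the scalar blocks \<open>\<epsilon> n\<close> times the
  identity, so that every block is a periodic linear system with a sign of its own.
\<close>

type_synonym block_diag = "nat \<Rightarrow> complex^2^2"

definition bd_entry :: "block_diag \<Rightarrow> nat \<times> 2 \<Rightarrow> nat \<times> 2 \<Rightarrow> complex" where
  "bd_entry M p q = (if fst p = fst q then M (fst p) $ snd p $ snd q else 0)"

text \<open>The sum of all diagonal entries, required to converge unconditionally.\<close>

definition bd_has_trace :: "block_diag \<Rightarrow> complex \<Rightarrow> bool" where
  "bd_has_trace M t \<longleftrightarrow> ((\<lambda>p. bd_entry M p p) has_sum t) UNIV"

definition bd_periodic_linear_system ::
  "(nat \<Rightarrow> real) \<Rightarrow> block_diag \<Rightarrow> block_diag \<Rightarrow> block_diag \<Rightarrow> block_diag \<Rightarrow> bool" where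
  "bd_periodic_linear_system \<epsilon> A B C E \<longleftrightarrow>
     (\<forall>n. periodic_linear_system (\<epsilon> n) (A n) (B n) (C n) (E n))"

definition bd_resolvent_invertible :: "block_diag \<Rightarrow> block_diag \<Rightarrow> complex \<Rightarrow> bool" where
  "bd_resolvent_invertible A E x \<longleftrightarrow> (\<forall>n. invertible (resolvent_matrix (A n) (E n) x))"

definition bd_W ::
  "block_diag \<Rightarrow> block_diag \<Rightarrow> block_diag \<Rightarrow> block_diag \<Rightarrow> complex \<Rightarrow> complex \<Rightarrow> block_diag" where
  "bd_W A B C E x y = (\<lambda>n. W_fun (A n) (B n) (C n) (E n) x y)"


subsection \<open>Elliptic functions\<close>

definition elliptic :: "complex \<Rightarrow> complex \<Rightarrow> (complex \<Rightarrow> complex) \<Rightarrow> bool" where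
  "elliptic \<omega>1 \<omega>2 f \<longleftrightarrow>
     Im (\<omega>2 / \<omega>1) > 0 \<and> f meromorphic_on UNIV \<and>
     (\<forall>z. f (z + \<omega>1) = f z) \<and> (\<forall>z. f (z + \<omega>2) = f z)"

text \<open>
  The derivative of \<open>log f\<close>, for any local branch of the logarithm, at points where \<open>f\<close> is
  analytic and nonzero.
\<close>

definition log_deriv :: "(complex \<Rightarrow> complex) \<Rightarrow> complex \<Rightarrow> complex" where
  "log_deriv f x = deriv f x / f x"

text \<open>
  The relation \<open>exp 2\<pi>A = I\<close> makes \<open>W(x,x)\<close> periodic in \<open>x\<close> with period \<open>\<pi>\<close>: the involution
  \<open>exp(-\<pi>A)\<close> commutes with \<open>A\<close> and \<open>E\<close> and occurs twice. Hence \<open>trace W(x,x)\<close> can only be the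
  logarithmic derivative of a function in the variable in which a period of the lattice is \<open>\<pi>\<close>
  (the classical convention for Jacobi theta functions). For general periods the variable is
  rescaled accordingly; the rescaling is the identity when \<open>\<omega>1 = \<pi>\<close>.
\<close>

definition period_normalized :: "complex \<Rightarrow> (complex \<Rightarrow> complex) \<Rightarrow> complex \<Rightarrow> complex" where
  "period_normalized \<omega>1 f = (\<lambda>x. f (\<omega>1 / of_real pi * x))"

end

theory Submission
  imports Defs "HOL-Library.Nat_Bijection"
begin

text \<open>
  If \<open>A\<close> and \<open>E\<close> commute, then by cyclicity of the trace
  \<open>trace W(x,x) = \<epsilon> (d/dx) log det (I - E exp(-2xA))\<close>. The relation \<open>exp(2\<pi>A) = I\<close> puts the
  eigenvalues of \<open>A\<close> into \<open>\<i>\<int>\<close>, so a block with \<open>A = diag(\<plusminus>\<i>, 0)\<close> and \<open>E = diag(e, 0)\<close> realizes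
  the logarithmic derivative of one factor \<open>1 - e exp(\<mp>2\<i>x)\<close>, raised to the power \<open>\<epsilon>\<close>. What has
  to be shown is therefore that an elliptic function of period \<open>\<pi>\<close> is a product of such factors,
  in a form in which the logarithmic derivatives sum unconditionally.

  These are the factors of the theta function. With \<open>t = \<omega>2/\<omega>1\<close> and \<open>q = exp(2\<pi>\<i>t)\<close> let
  \<open>\<theta>(x) = G(exp(2\<i>x)) G(q exp(-2\<i>x))\<close>, where \<open>G(u) = (1 - u)(1 - qu)(1 - q\<^sup>2u)\<dots>\<close> is the Euler
  function. It is entire with simple zeros exactly at the lattice \<open>\<pi>\<int> + \<pi>t\<int>\<close>, it has period \<open>\<pi>\<close>, and
  \<open>\<theta>(x + \<pi>t) = - exp(-2\<i>x) \<theta>(x)\<close>. Everything about \<open>G\<close> follows from \<open>G(0) = 1\<close> and the functional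
  equation \<open>G(u) = (1 - u) G(qu)\<close>: iteration of that equation yields the zeros and the partial fraction
  series of \<open>G'/G\<close>, which converges geometrically.

  Let \<open>f\<close> be the normalized elliptic function and \<open>m a\<close> its order at \<open>a\<close>. Dividing \<open>f\<close> by
  \<open>\<Prod> \<theta>(x - a) powi m a\<close>, where \<open>a\<close> runs through the finitely many zeros and poles in a period cell, leaves
  an entire function \<open>H\<close> without zeros that is quasi-periodic. The derivative of \<open>H'/H\<close> is
  entire and doubly periodic, hence constant by Liouville, and the period \<open>\<pi>\<close> leaves only
  \<open>H(x) = c exp(2\<i>kx)\<close> with an integer \<open>k\<close>. So
  \<open>f'/f = 2\<i>k + \<Sum> m a \<cdot> \<theta>'/\<theta>(x - a)\<close>.

  The constant \<open>2\<i>k\<close> is also a sum of block traces: two blocks whose factors are \<open>1 - y\<close> and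
  \<open>1/(1 - 1/y)\<close> with \<open>y = exp(2\<i>(x - a))\<close> multiply to \<open>-y\<close>, whose logarithmic derivative is \<open>2\<i>\<close>.
  Their resolvents are singular only where \<open>y = 1\<close>, which is harmless if \<open>a\<close> is a zero or a
  pole of \<open>f\<close>. If \<open>f\<close> has neither, then \<open>f\<close> itself is \<open>c exp(2\<i>kx)\<close> and its second period forces
  \<open>k = 0\<close>.
\<close>

section \<open>Diagonal two by two matrices\<close>

definition diag2 :: "complex \<Rightarrow> complex \<Rightarrow> complex^2^2" where
  "diag2 a b = (\<chi> i j. if i = j then (if i = 1 then a else b) else 0)"

lemma diag2_nth [simp]:
  "diag2 a b $ 1 $ 1 = a" "diag2 a b $ 2 $ 2 = b" "diag2 a b $ 1 $ 2 = 0" "diag2 a b $ 2 $ 1 = 0"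
  by (simp_all add: diag2_def)

lemma diag2_mult: "diag2 a b ** diag2 c d = diag2 (a * c) (b * d)"
  by (simp add: vec_eq_iff forall_2 matrix_matrix_mult_def sum_2)

lemma diag2_add: "diag2 a b + diag2 c d = diag2 (a + c) (b + d)"
  by (simp add: vec_eq_iff forall_2)

lemma diag2_diff: "diag2 a b - diag2 c d = diag2 (a - c) (b - d)"
  by (simp add: vec_eq_iff forall_2)

lemma diag2_scaleR: "r *\<^sub>R diag2 a b = diag2 (of_real r * a) (of_real r * b)"
  by (simp add: vec_eq_iff forall_2) (simp add: scaleR_conv_of_real)

lemma diag2_scale: "mat_scale c (diag2 a b) = diag2 (c * a) (c * b)"
  by (simp add: vec_eq_iff forall_2 map_matrix_def)

lemma mat_1_eq_diag2: "mat 1 = diag2 1 1"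
  by (simp add: vec_eq_iff forall_2 mat_def)

lemma mat_power_diag2: "mat_power (diag2 a b) k = diag2 (a ^ k) (b ^ k)"
  by (induction k) (simp_all add: mat_1_eq_diag2 diag2_mult)

lemma mat_exp_diag2: "mat_exp (diag2 a b) = diag2 (exp a) (exp b)"
proof -
  have "(\<lambda>k. (1 / fact k) *\<^sub>R mat_power (diag2 a b) k) sums diag2 (exp a) (exp b)"
    unfolding sums_def
  proof (intro vec_tendstoI)
    fix i j :: 2
    have s: "(\<lambda>n. \<Sum>k<n. complex_of_real (1 / fact k) * z ^ k) \<longlonglongrightarrow> exp z" for z :: complex
      using exp_converges[of z] by (simp add: sums_def scaleR_conv_of_real divide_inverse)
    show "(\<lambda>n. (\<Sum>k<n. (1 / fact k) *\<^sub>R mat_power (diag2 a b) k) $ i $ j)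
            \<longlonglongrightarrow> diag2 (exp a) (exp b) $ i $ j"
      using exhaust_2[of i] exhaust_2[of j] s[of a] s[of b]
      by (auto simp: mat_power_diag2 diag2_scaleR)
  qed
  thus ?thesis
    unfolding mat_exp_def by (rule sums_unique [symmetric])
qed

lemma
  assumes "a \<noteq> 0" "b \<noteq> 0"
  shows diag2_invertible: "invertible (diag2 a b)"
    and diag2_matrix_inv: "matrix_inv (diag2 a b) = diag2 (1 / a) (1 / b)"
proof -
  have inv: "diag2 a b ** diag2 (1 / a) (1 / b) = mat 1" "diag2 (1 / a) (1 / b) ** diag2 a b = mat 1"
    using assms by (simp_all add: diag2_mult mat_1_eq_diag2)
  thus 1: "invertible (diag2 a b)"
    unfolding invertible_def by blast
  have "diag2 a b ** matrix_inv (diag2 a b) = mat 1 \<and> matrix_inv (diag2 a b) ** diag2 a b = mat 1"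
    unfolding matrix_inv_def by (rule someI_ex) (use inv in blast)
  hence "matrix_inv (diag2 a b) = (diag2 (1 / a) (1 / b) ** diag2 a b) ** matrix_inv (diag2 a b)"
    using inv by simp
  also have "\<dots> = diag2 (1 / a) (1 / b)"
    using \<open>_ \<and> _\<close> by (simp flip: matrix_mul_assoc)
  finally show "matrix_inv (diag2 a b) = diag2 (1 / a) (1 / b)" .
qed

section \<open>Block systems and sums of logarithmic derivatives\<close>

text \<open>
  This is the logarithmic derivative of \<open>(1 - e exp(-2 \<kappa> x))\<close> raised to the power \<open>\<epsilon>\<close>.
\<close>

definition log_deriv_term :: "real \<Rightarrow> complex \<Rightarrow> complex \<Rightarrow> complex \<Rightarrow> complex" where
  "log_deriv_term \<epsilon> \<kappa> e x = of_real \<epsilon> * (2 * \<kappa> * e * exp (- 2 * \<kappa> * x) / (1 - e * exp (- 2 * \<kappa> * x)))"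

text \<open>
  Matrices are confined to the translation of this property into a block system. The property
  itself, which asks for one term per block and for invertible resolvents on \<open>S\<close>, is closed under integer
  combinations of the functions \<open>g\<close>, so that the theta functions and the constant can be treated
  separately.
\<close>

definition factor_series_on :: "complex set \<Rightarrow> (complex \<Rightarrow> complex) \<Rightarrow> bool" where
  "factor_series_on S g \<longleftrightarrow>
     (\<exists>(\<epsilon> :: nat \<Rightarrow> real) (\<kappa> :: nat \<Rightarrow> complex) (e :: nat \<Rightarrow> complex).
        (\<forall>n. (\<epsilon> n = 1 \<or> \<epsilon> n = -1) \<and> (\<kappa> n = \<i> \<or> \<kappa> n = -\<i>)) \<and>
        (\<forall>x\<in>S. (\<forall>n. e n * exp (- 2 * \<kappa> n * x) \<noteq> 1) \<and>
                ((\<lambda>n. log_deriv_term (\<epsilon> n) (\<kappa> n) (e n) x) has_sum g x) UNIV))"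

lemma exp_two_pi_unit:
  assumes "\<kappa> = \<i> \<or> \<kappa> = -\<i>"
  shows "exp (of_real (2 * pi) * \<kappa>) = 1"
  using assms by (auto simp: exp_eq_1 intro: exI[of _ "1::int"] exI[of _ "-1::int"])

text \<open>
  With \<open>B = I\<close> the relation \<open>BC = \<epsilon>(AE + EA)\<close> becomes the definition of \<open>C\<close>, and the other relations
  hold because diagonal matrices commute. The second diagonal position is idle, so that a block
  carries exactly one term.
\<close>

lemma periodic_linear_system_diag2:
  assumes "\<epsilon> = 1 \<or> \<epsilon> = -1" "\<kappa> = \<i> \<or> \<kappa> = -\<i>"
  shows "periodic_linear_system \<epsilon> (diag2 \<kappa> 0) (mat 1) (diag2 (of_real \<epsilon> * (2 * \<kappa> * e)) 0) (diag2 e 0)"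
  using assms exp_two_pi_unit[OF assms(2)]
  by (simp add: periodic_linear_system_def mat_1_eq_diag2 diag2_mult diag2_add diag2_scaleR
        diag2_scale mat_exp_diag2 mult_ac)

lemma resolvent_matrix_diag2:
  "resolvent_matrix (diag2 \<kappa> 0) (diag2 e 0) x = diag2 (1 - e * exp (- 2 * \<kappa> * x)) 1"
proof -
  have "exp (- x * \<kappa>) * e * exp (- x * \<kappa>) = e * (exp (- x * \<kappa>) * exp (- x * \<kappa>))"
    by (simp only: mult_ac)
  also have "exp (- x * \<kappa>) * exp (- x * \<kappa>) = exp (- 2 * \<kappa> * x)"
    by (simp add: mult_exp_exp algebra_simps)
  finally show ?thesis
    by (simp only: resolvent_matrix_def mat_1_eq_diag2 diag2_mult diag2_diff diag2_scale mat_exp_diag2)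
       simp
qed

lemma W_fun_diag2:
  assumes "e * exp (- 2 * \<kappa> * x) \<noteq> 1"
  shows "W_fun (diag2 \<kappa> 0) (mat 1) (diag2 (of_real \<epsilon> * (2 * \<kappa> * e)) 0) (diag2 e 0) x x =
           diag2 (log_deriv_term \<epsilon> \<kappa> e x) 0"
proof -
  let ?y = "exp (- x * \<kappa>)"
  have y: "exp (- 2 * \<kappa> * x) = ?y * ?y"
    by (simp add: mult_exp_exp algebra_simps)
  have "matrix_inv (resolvent_matrix (diag2 \<kappa> 0) (diag2 e 0) x) = diag2 (1 / (1 - e * (?y * ?y))) 1"
    using assms unfolding resolvent_matrix_diag2 y by (subst diag2_matrix_inv) simp_all
  thus ?thesis
    unfolding W_fun_def log_deriv_term_def y
    by (simp add: mat_1_eq_diag2 diag2_mult diag2_scale mat_exp_diag2 mult_ac)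
qed

lemma bd_system_of_factor_series:
  assumes "factor_series_on S g"
  shows "\<exists>\<epsilon> A B C E. bd_periodic_linear_system \<epsilon> A B C E \<and>
           (\<forall>x\<in>S. bd_resolvent_invertible A E x \<and> bd_has_trace (bd_W A B C E x x) (g x))"
proof -
  from assms obtain \<epsilon> :: "nat \<Rightarrow> real" and \<kappa> e :: "nat \<Rightarrow> complex" where
    sgn: "\<And>n. \<epsilon> n = 1 \<or> \<epsilon> n = -1" "\<And>n. \<kappa> n = \<i> \<or> \<kappa> n = -\<i>" and
    nz: "\<And>x n. x \<in> S \<Longrightarrow> e n * exp (- 2 * \<kappa> n * x) \<noteq> 1" and
    sm: "\<And>x. x \<in> S \<Longrightarrow> ((\<lambda>n. log_deriv_term (\<epsilon> n) (\<kappa> n) (e n) x) has_sum g x) UNIV"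
    unfolding factor_series_on_def by blast
  define A B C E where "A = (\<lambda>n. diag2 (\<kappa> n) 0)" and "B = (\<lambda>n::nat. mat 1 :: complex^2^2)"
    and "C = (\<lambda>n. diag2 (of_real (\<epsilon> n) * (2 * \<kappa> n * e n)) 0)" and "E = (\<lambda>n. diag2 (e n) 0)"
  note defs = A_def B_def C_def E_def
  have "bd_has_trace (bd_W A B C E x x) (g x)" if x: "x \<in> S" for x
  proof -
    let ?t = "\<lambda>n. log_deriv_term (\<epsilon> n) (\<kappa> n) (e n) x"
    have entry: "bd_entry (bd_W A B C E x x) p p = diag2 (?t (fst p)) 0 $ snd p $ snd p" for p
      using nz[OF x] by (simp add: bd_entry_def bd_W_def defs W_fun_diag2)
    have "((\<lambda>p::nat \<times> 2. diag2 (?t (fst p)) 0 $ snd p $ snd p) has_sum g x) (range (\<lambda>n. (n, 1)))"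
      using sm[OF x] by (subst has_sum_reindex) (auto simp: inj_on_def o_def)
    also have "?this \<longleftrightarrow> ((\<lambda>p::nat \<times> 2. diag2 (?t (fst p)) 0 $ snd p $ snd p) has_sum g x) UNIV"
    proof (rule has_sum_cong_neutral)
      fix p :: "nat \<times> 2"
      assume "p \<in> UNIV - range (\<lambda>n. (n, 1))"
      thus "diag2 (?t (fst p)) 0 $ snd p $ snd p = 0"
        using exhaust_2[of "snd p"] by (cases p) auto
    qed auto
    finally show ?thesis
      unfolding bd_has_trace_def entry .
  qed
  moreover have "bd_resolvent_invertible A E x" if "x \<in> S" for x
    unfolding bd_resolvent_invertible_def defs resolvent_matrix_diag2
    using nz[OF that] by (auto intro!: diag2_invertible)
  moreover have "bd_periodic_linear_system \<epsilon> A B C E"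
    unfolding bd_periodic_linear_system_def defs
    using sgn by (auto intro!: periodic_linear_system_diag2)
  ultimately show ?thesis
    by blast
qed

lemma factor_series_on_cong:
  assumes "\<And>x. x \<in> S \<Longrightarrow> g x = h x"
  shows "factor_series_on S g \<longleftrightarrow> factor_series_on S h"
  unfolding factor_series_on_def using assms by (simp cong: ball_cong)

lemma factor_series_on_0: "factor_series_on S (\<lambda>_. 0)"
  unfolding factor_series_on_def
  by (intro exI[of _ "\<lambda>_. 1"] exI[of _ "\<lambda>_. \<i>"] exI[of _ "\<lambda>_. 0"]) (simp add: log_deriv_term_def)

lemma factor_series_on_uminus:
  assumes "factor_series_on S g"
  shows "factor_series_on S (\<lambda>x. - g x)"
proof -
  from assms obtain \<epsilon> :: "nat \<Rightarrow> real" and \<kappa> e :: "nat \<Rightarrow> complex" where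
    sgn: "\<And>n. \<epsilon> n = 1 \<or> \<epsilon> n = -1" "\<And>n. \<kappa> n = \<i> \<or> \<kappa> n = -\<i>" and
    nz: "\<And>x n. x \<in> S \<Longrightarrow> e n * exp (- 2 * \<kappa> n * x) \<noteq> 1" and
    sm: "\<And>x. x \<in> S \<Longrightarrow> ((\<lambda>n. log_deriv_term (\<epsilon> n) (\<kappa> n) (e n) x) has_sum g x) UNIV"
    unfolding factor_series_on_def by blast
  have "((\<lambda>n. log_deriv_term (- \<epsilon> n) (\<kappa> n) (e n) x) has_sum - g x) UNIV" if "x \<in> S" for x
    using sm[OF that] by (simp add: log_deriv_term_def has_sum_uminus)
  thus ?thesis
    unfolding factor_series_on_def
    by (intro exI[of _ "\<lambda>n. - \<epsilon> n"] exI[of _ \<kappa>] exI[of _ e]) (use sgn nz in auto)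
qed

text \<open>
  The two families are interleaved; unconditional convergence makes the order irrelevant.
\<close>

lemma factor_series_on_add:
  assumes "factor_series_on S g" "factor_series_on S h"
  shows "factor_series_on S (\<lambda>x. g x + h x)"
proof -
  from assms(1) obtain \<epsilon> :: "nat \<Rightarrow> real" and \<kappa> e :: "nat \<Rightarrow> complex" where
    1: "\<And>n. \<epsilon> n = 1 \<or> \<epsilon> n = -1" "\<And>n. \<kappa> n = \<i> \<or> \<kappa> n = -\<i>"
       "\<And>x n. x \<in> S \<Longrightarrow> e n * exp (- 2 * \<kappa> n * x) \<noteq> 1"
       "\<And>x. x \<in> S \<Longrightarrow> ((\<lambda>n. log_deriv_term (\<epsilon> n) (\<kappa> n) (e n) x) has_sum g x) UNIV"
    unfolding factor_series_on_def by blast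
  from assms(2) obtain \<epsilon>' :: "nat \<Rightarrow> real" and \<kappa>' e' :: "nat \<Rightarrow> complex" where
    2: "\<And>n. \<epsilon>' n = 1 \<or> \<epsilon>' n = -1" "\<And>n. \<kappa>' n = \<i> \<or> \<kappa>' n = -\<i>"
       "\<And>x n. x \<in> S \<Longrightarrow> e' n * exp (- 2 * \<kappa>' n * x) \<noteq> 1"
       "\<And>x. x \<in> S \<Longrightarrow> ((\<lambda>n. log_deriv_term (\<epsilon>' n) (\<kappa>' n) (e' n) x) has_sum h x) UNIV"
    unfolding factor_series_on_def by blast
  define T where "T = (\<lambda>x p. log_deriv_term (case_sum \<epsilon> \<epsilon>' p) (case_sum \<kappa> \<kappa>' p) (case_sum e e' p) x)"
  have "((\<lambda>n. T x (sum_decode n)) has_sum (g x + h x)) UNIV" if x: "x \<in> S" for x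
  proof -
    have "(T x has_sum g x) (range Inl)" "(T x has_sum h x) (range Inr)"
      using 1(4)[OF x] 2(4)[OF x] by (simp_all add: has_sum_reindex T_def o_def)
    hence "(T x has_sum (g x + h x)) (range Inl \<union> range Inr)"
      by (rule has_sum_Un_disjoint) auto
    also have "range Inl \<union> range Inr = (UNIV :: (nat + nat) set)"
      by (simp add: UNIV_sum)
    finally show ?thesis
      using has_sum_reindex_bij_betw[OF bij_sum_decode] by metis
  qed
  moreover have "case_sum \<epsilon> \<epsilon>' p = 1 \<or> case_sum \<epsilon> \<epsilon>' p = -1" "case_sum \<kappa> \<kappa>' p = \<i> \<or> case_sum \<kappa> \<kappa>' p = -\<i>" for p
    using 1 2 by (cases p; auto)+
  moreover have "case_sum e e' p * exp (- 2 * case_sum \<kappa> \<kappa>' p * x) \<noteq> 1" if "x \<in> S" for p x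
    using 1(3)[OF that] 2(3)[OF that] by (cases p) auto
  ultimately show ?thesis
    unfolding factor_series_on_def T_def
    by (intro exI[of _ "\<lambda>n. case_sum \<epsilon> \<epsilon>' (sum_decode n)"] exI[of _ "\<lambda>n. case_sum \<kappa> \<kappa>' (sum_decode n)"]
          exI[of _ "\<lambda>n. case_sum e e' (sum_decode n)"]) auto
qed

lemma factor_series_on_of_int_mult:
  assumes "factor_series_on S g"
  shows "factor_series_on S (\<lambda>x. of_int k * g x)"
proof -
  have nat: "factor_series_on S (\<lambda>x. of_nat m * g x)" for m
  proof (induction m)
    case (Suc m)
    thus ?case
      using factor_series_on_add[OF assms Suc] by (simp add: algebra_simps)
  qed (use factor_series_on_0 in simp)
  show ?thesis
  proof (cases k)
    case (nonneg n)
    thus ?thesis using nat[of n] by simp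
  next
    case (neg n)
    hence "of_int k = - complex_of_nat (Suc n)"
      by simp
    thus ?thesis
      using factor_series_on_uminus[OF nat[of "Suc n"]] by (simp only: mult_minus_left)
  qed
qed

lemma factor_series_on_sum:
  assumes "\<And>a. a \<in> R \<Longrightarrow> factor_series_on S (g a)"
  shows "factor_series_on S (\<lambda>x. \<Sum>a\<in>R. g a x)"
  using assms
  by (induction R rule: infinite_finite_induct) (auto intro: factor_series_on_0 factor_series_on_add)

text \<open>
  The family is padded with terms for \<open>e = 0\<close>, which vanish.
\<close>

lemma factor_series_on_single:
  assumes "\<epsilon> = 1 \<or> \<epsilon> = -1" "\<kappa> = \<i> \<or> \<kappa> = -\<i>" "\<And>x. x \<in> S \<Longrightarrow> e * exp (- 2 * \<kappa> * x) \<noteq> 1"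
  shows "factor_series_on S (log_deriv_term \<epsilon> \<kappa> e)"
proof -
  define e' where "e' = (\<lambda>n::nat. if n = 0 then e else 0)"
  have "((\<lambda>n. log_deriv_term \<epsilon> \<kappa> (e' n) x) has_sum log_deriv_term \<epsilon> \<kappa> e x) UNIV" for x
  proof -
    have "((\<lambda>n. log_deriv_term \<epsilon> \<kappa> (e' n) x) has_sum log_deriv_term \<epsilon> \<kappa> e x) {0}"
      by (rule has_sum_finiteI) (auto simp: e'_def)
    also have "?this \<longleftrightarrow> ?thesis"
      by (rule has_sum_cong_neutral) (auto simp: e'_def log_deriv_term_def)
    finally show ?thesis .
  qed
  thus ?thesis
    unfolding factor_series_on_def
    by (intro exI[of _ "\<lambda>_. \<epsilon>"] exI[of _ "\<lambda>_. \<kappa>"] exI[of _ e']) (use assms in \<open>auto simp: e'_def\<close>)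
qed

text \<open>
  With \<open>y = exp(2\<i>(x - a))\<close> the quotient of \<open>1 - y\<close> by \<open>1 - 1/y\<close> is \<open>-y\<close>, and \<open>-y\<close> has logarithmic
  derivative \<open>2\<i>\<close>. The price of this realization of a constant is the excluded set \<open>y = 1\<close>.
\<close>

lemma factor_series_on_const:
  assumes "\<And>x. x \<in> S \<Longrightarrow> exp (2 * \<i> * (x - a)) \<noteq> 1"
  shows "factor_series_on S (\<lambda>_. 2 * \<i>)"
proof -
  have up: "exp (- 2 * \<i> * a) * exp (- 2 * (-\<i>) * x) = exp (2 * \<i> * (x - a))"
   and down: "exp (2 * \<i> * a) * exp (- 2 * \<i> * x) = inverse (exp (2 * \<i> * (x - a)))" for x
    unfolding mult_exp_exp exp_minus [symmetric] by (simp_all add: algebra_simps)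
  have nz: "exp (- 2 * \<i> * a) * exp (- 2 * (-\<i>) * x) \<noteq> 1"
           "exp (2 * \<i> * a) * exp (- 2 * \<i> * x) \<noteq> 1" if "x \<in> S" for x
    using assms[OF that] unfolding up down by simp_all
  have "factor_series_on S (\<lambda>x. log_deriv_term 1 (-\<i>) (exp (- 2 * \<i> * a)) x +
                                 log_deriv_term (-1) \<i> (exp (2 * \<i> * a)) x)"
    by (intro factor_series_on_add factor_series_on_single nz) auto
  moreover have "log_deriv_term 1 (-\<i>) (exp (- 2 * \<i> * a)) x +
                 log_deriv_term (-1) \<i> (exp (2 * \<i> * a)) x = 2 * \<i>" if "x \<in> S" for x
  proof -
    define y where "y = exp (2 * \<i> * (x - a))"
    have y: "y \<noteq> 0" "y \<noteq> 1" using assms[OF that] by (auto simp: y_def)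
    have "log_deriv_term 1 (-\<i>) (exp (- 2 * \<i> * a)) x + log_deriv_term (-1) \<i> (exp (2 * \<i> * a)) x =
            2 * (-\<i>) * y / (1 - y) - 2 * \<i> * inverse y / (1 - inverse y)"
      unfolding log_deriv_term_def mult.assoc[of _ "exp _" "exp _"] up down y_def by simp
    also have "inverse y / (1 - inverse y) = 1 / (y - 1)"
      using y by (simp add: field_simps)
    hence "2 * \<i> * inverse y / (1 - inverse y) = 2 * \<i> / (y - 1)"
      by (metis times_divide_eq_right mult.right_neutral)
    also have "2 * (-\<i>) * y / (1 - y) = 2 * \<i> * y / (y - 1)"
      using y by (simp add: divide_simps) (simp add: algebra_simps)
    also have "2 * \<i> * y / (y - 1) - 2 * \<i> / (y - 1) = 2 * \<i> * (y - 1) / (y - 1)"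
      by (simp add: diff_divide_distrib right_diff_distrib)
    also have "\<dots> = 2 * \<i>"
      using y by simp
    finally show ?thesis .
  qed
  ultimately show ?thesis
    by (rule factor_series_on_cong[THEN iffD1, rotated])
qed

section \<open>The Euler function\<close>

text \<open>
  The Taylor coefficients of \<open>(1 - u)(1 - qu)(1 - q\<^sup>2u)\<dots>\<close>, as found by Euler. Starting from the power
  series makes holomorphy immediate and leaves the product as a consequence.
\<close>

definition euler_coeff :: "complex \<Rightarrow> nat \<Rightarrow> complex" where
  "euler_coeff q n = (\<Prod>k<n. - (q ^ k) / (1 - q ^ Suc k))"

definition euler_fun :: "complex \<Rightarrow> complex \<Rightarrow> complex" where
  "euler_fun q u = (\<Sum>n. euler_coeff q n * u ^ n)"

lemma power_Suc_neq_1: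
  assumes "norm (q :: complex) < 1"
  shows "q ^ Suc n \<noteq> 1"
proof
  assume "q ^ Suc n = 1"
  moreover have "norm (q ^ Suc n) \<le> norm q * 1"
    using assms unfolding norm_power power_Suc norm_mult by (intro mult_left_mono power_le_one) auto
  ultimately show False
    using assms by simp
qed

lemma euler_coeff_sums:
  assumes q: "norm q < 1"
  shows "(\<lambda>n. euler_coeff q n * u ^ n) sums euler_fun q u"
proof -
  have q0: "(\<lambda>n. q ^ n) \<longlonglongrightarrow> 0"
    using q by (rule LIMSEQ_power_zero)
  have "(\<lambda>n. norm (q ^ n * u / (1 - q ^ Suc n))) \<longlonglongrightarrow> norm (0 * u / (1 - 0))"
    by (intro tendsto_intros q0 LIMSEQ_Suc[OF q0]) auto
  hence "eventually (\<lambda>n. norm (q ^ n * u / (1 - q ^ Suc n)) < 1 / 2) sequentially"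
    by (rule order_tendstoD) auto
  then obtain N where N: "\<And>n. n \<ge> N \<Longrightarrow> norm (q ^ n * u / (1 - q ^ Suc n)) < 1 / 2"
    by (auto simp: eventually_at_top_linorder)
  have "summable (\<lambda>n. euler_coeff q n * u ^ n)"
  proof (rule summable_ratio_test[of "1/2" N])
    fix n assume "N \<le> n"
    have "norm (euler_coeff q (Suc n) * u ^ Suc n) =
            norm (euler_coeff q n * u ^ n) * norm (q ^ n * u / (1 - q ^ Suc n))"
      by (simp add: euler_coeff_def norm_mult norm_divide)
    also have "\<dots> \<le> norm (euler_coeff q n * u ^ n) * (1 / 2)"
      using N[OF \<open>N \<le> n\<close>] by (intro mult_left_mono) auto
    finally show "norm (euler_coeff q (Suc n) * u ^ Suc n) \<le> 1 / 2 * norm (euler_coeff q n * u ^ n)"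
      by simp
  qed auto
  thus ?thesis
    unfolding euler_fun_def by (rule summable_sums)
qed

lemma euler_fun_holomorphic:
  assumes "norm q < 1"
  shows "euler_fun q holomorphic_on UNIV"
proof -
  have "euler_fun q holomorphic_on ball 0 r" for r
    by (rule power_series_holomorphic[where a = "euler_coeff q"])
       (use euler_coeff_sums[OF assms] in simp)
  hence "euler_fun q field_differentiable at u" for u
    by (meson centre_in_ball holomorphic_on_imp_differentiable_at mem_ball_0 open_ball gt_ex)
  thus ?thesis
    by (simp add: holomorphic_on_def)
qed

lemma euler_fun_holomorphic_compose [holomorphic_intros]:
  assumes "h holomorphic_on A" "norm q < 1"
  shows "(\<lambda>x. euler_fun q (h x)) holomorphic_on A"
  using holomorphic_on_compose_gen[OF assms(1) euler_fun_holomorphic[OF assms(2)]]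
  by (simp add: o_def)

lemma euler_fun_0: "norm q < 1 \<Longrightarrow> euler_fun q 0 = 1"
  using powser_sums_zero[of "euler_coeff q"] sums_unique2[OF euler_coeff_sums[of q 0]]
  by (fastforce simp: euler_coeff_def)

text \<open>
  Comparing coefficients, the equation is the recursion
  \<open>(1 - q\<^sup>n\<^sup>+\<^sup>1) c\<^sub>n\<^sub>+\<^sub>1 = - q\<^sup>n c\<^sub>n\<close>. The further properties of the Euler function rest on this equation
  and on its value \<open>1\<close> at \<open>0\<close>.
\<close>

lemma euler_fun_rec:
  assumes q: "norm q < 1"
  shows "euler_fun q u = (1 - u) * euler_fun q (q * u)"
proof -
  have "(\<lambda>n. euler_coeff q n * u ^ n - euler_coeff q n * (q * u) ^ n) sums
          (euler_fun q u - euler_fun q (q * u))"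
    by (intro sums_diff euler_coeff_sums q)
  hence "(\<lambda>n. euler_coeff q (Suc n) * u ^ Suc n - euler_coeff q (Suc n) * (q * u) ^ Suc n) sums
          (euler_fun q u - euler_fun q (q * u))"
    by (subst sums_Suc_iff) simp
  also have "(\<lambda>n. euler_coeff q (Suc n) * u ^ Suc n - euler_coeff q (Suc n) * (q * u) ^ Suc n) =
             (\<lambda>n. - u * (euler_coeff q n * (q * u) ^ n))"
  proof
    fix n
    have "euler_coeff q (Suc n) * (1 - q ^ Suc n) = - (q ^ n) * euler_coeff q n"
      using power_Suc_neq_1[OF q, of n] by (simp add: euler_coeff_def)
    moreover have "euler_coeff q (Suc n) * u ^ Suc n - euler_coeff q (Suc n) * (q * u) ^ Suc n =
          euler_coeff q (Suc n) * (1 - q ^ Suc n) * u ^ Suc n"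
      by (simp add: algebra_simps power_mult_distrib)
    ultimately show "euler_coeff q (Suc n) * u ^ Suc n - euler_coeff q (Suc n) * (q * u) ^ Suc n =
          - u * (euler_coeff q n * (q * u) ^ n)"
      by (simp add: power_mult_distrib)
  qed
  finally have "(\<lambda>n. - u * (euler_coeff q n * (q * u) ^ n)) sums (euler_fun q u - euler_fun q (q * u))" .
  moreover have "(\<lambda>n. - u * (euler_coeff q n * (q * u) ^ n)) sums (- u * euler_fun q (q * u))"
    by (intro sums_mult euler_coeff_sums q)
  ultimately have "euler_fun q u - euler_fun q (q * u) = - u * euler_fun q (q * u)"
    by (rule sums_unique2)
  thus ?thesis
    by (simp add: algebra_simps)
qed

lemma euler_fun_prod:
  assumes q: "norm q < 1"
  shows "euler_fun q u = (\<Prod>n<N. 1 - q ^ n * u) * euler_fun q (q ^ N * u)"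
proof (induction N)
  case (Suc N)
  thus ?case using euler_fun_rec[OF q, of "q ^ N * u"] by (simp add: mult_ac)
qed simp

lemma euler_fun_tendsto_1:
  assumes q: "norm q < 1"
  shows "(\<lambda>N. euler_fun q (q ^ N * u)) \<longlonglongrightarrow> 1"
proof -
  have "(\<lambda>N. q ^ N * u) \<longlonglongrightarrow> 0 * u"
    using q by (intro tendsto_intros LIMSEQ_power_zero)
  moreover have "isCont (euler_fun q) 0"
    using euler_fun_holomorphic[OF q]
    by (metis UNIV_I continuous_on_eq_continuous_at holomorphic_on_imp_continuous_on open_UNIV)
  ultimately show ?thesis
    using isCont_tendsto_compose[of 0 "euler_fun q"] euler_fun_0[OF q] by fastforce
qed

text \<open>
  Since \<open>G(q\<^sup>N u)\<close> tends to \<open>1\<close>, a zero must come from one of the first \<open>N\<close> factors for some \<open>N\<close>.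
\<close>

lemma euler_fun_eq_0_iff:
  assumes q: "norm q < 1"
  shows "euler_fun q u = 0 \<longleftrightarrow> (\<exists>n. q ^ n * u = 1)"
proof
  have "eventually (\<lambda>N. euler_fun q (q ^ N * u) \<noteq> 0) sequentially"
    using euler_fun_tendsto_1[OF q] by (rule tendsto_imp_eventually_ne) auto
  then obtain N where N: "euler_fun q (q ^ N * u) \<noteq> 0"
    by (auto simp: eventually_at_top_linorder)
  assume "euler_fun q u = 0"
  thus "\<exists>n. q ^ n * u = 1"
    using euler_fun_prod[OF q, of u N] N by auto
next
  assume "\<exists>n. q ^ n * u = 1"
  then obtain n where "q ^ n * u = 1" by blast
  thus "euler_fun q u = 0"
    using euler_fun_prod[OF q, of u "Suc n"] by simp
qed

definition euler_log_deriv :: "complex \<Rightarrow> complex \<Rightarrow> complex" where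
  "euler_log_deriv q u = deriv (euler_fun q) u / euler_fun q u"

lemma euler_fun_has_derivative:
  assumes "norm q < 1"
  shows "(euler_fun q has_field_derivative deriv (euler_fun q) u) (at u)"
  using euler_fun_holomorphic[OF assms] holomorphic_derivI by blast

lemma euler_log_deriv_rec:
  assumes q: "norm q < 1" and nz: "euler_fun q u \<noteq> 0"
  shows "euler_log_deriv q u = - 1 / (1 - u) + q * euler_log_deriv q (q * u)"
proof -
  have nz': "u \<noteq> 1" "euler_fun q (q * u) \<noteq> 0"
    using nz euler_fun_rec[OF q, of u] by auto
  have "((\<lambda>u. (1 - u) * euler_fun q (q * u)) has_field_derivative
          - euler_fun q (q * u) + (1 - u) * (deriv (euler_fun q) (q * u) * q)) (at u)"
    by (rule derivative_eq_intros DERIV_chain2[OF euler_fun_has_derivative[OF q]] refl | simp)+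
  also have "(\<lambda>u. (1 - u) * euler_fun q (q * u)) = euler_fun q"
    by (rule ext, rule euler_fun_rec[OF q, symmetric])
  finally have d: "deriv (euler_fun q) u = - euler_fun q (q * u) + (1 - u) * (deriv (euler_fun q) (q * u) * q)"
    by (rule DERIV_imp_deriv)
  have "euler_log_deriv q u = (- euler_fun q (q * u) + (1 - u) * (deriv (euler_fun q) (q * u) * q)) /
          ((1 - u) * euler_fun q (q * u))"
    by (simp only: euler_log_deriv_def d euler_fun_rec[OF q, of u])
  also have "\<dots> = - 1 / (1 - u) + q * euler_log_deriv q (q * u)"
    unfolding euler_log_deriv_def using nz' by (simp add: field_simps)
  finally show ?thesis .
qed

text \<open>
  The logarithmic derivative of the functional equation is iterated; the remainder
  \<open>q\<^sup>N (G'/G)(q\<^sup>N u)\<close> tends to \<open>0\<close> because \<open>G'/G\<close> is continuous at \<open>0\<close>.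
\<close>

lemma euler_log_deriv_sums:
  assumes q: "norm q < 1" and nz: "euler_fun q u \<noteq> 0"
  shows "(\<lambda>n. - (q ^ n) / (1 - q ^ n * u)) sums euler_log_deriv q u"
proof -
  have partial: "euler_log_deriv q u =
                (\<Sum>n<N. - (q ^ n) / (1 - q ^ n * u)) + q ^ N * euler_log_deriv q (q ^ N * u)" for N
  proof (induction N)
    case (Suc N)
    have "euler_fun q (q ^ N * u) \<noteq> 0"
      using nz euler_fun_prod[OF q, of u N] by auto
    hence "euler_log_deriv q (q ^ N * u) = - 1 / (1 - q ^ N * u) + q * euler_log_deriv q (q ^ Suc N * u)"
      using euler_log_deriv_rec[OF q, of "q ^ N * u"] by (simp add: mult_ac)
    hence "q ^ N * euler_log_deriv q (q ^ N * u) =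
             - (q ^ N) / (1 - q ^ N * u) + q ^ Suc N * euler_log_deriv q (q ^ Suc N * u)"
      by (simp add: ring_distribs mult_ac)
    thus ?case
      using Suc by simp
  qed simp
  have "isCont (deriv (euler_fun q)) 0"
    using euler_fun_holomorphic[OF q]
    by (metis UNIV_I continuous_on_eq_continuous_at holomorphic_deriv holomorphic_on_imp_continuous_on open_UNIV)
  moreover have 0: "(\<lambda>N. q ^ N * u) \<longlonglongrightarrow> 0"
    using q by (intro tendsto_mult_left_zero LIMSEQ_power_zero)
  ultimately have "(\<lambda>N. deriv (euler_fun q) (q ^ N * u)) \<longlonglongrightarrow> deriv (euler_fun q) 0"
    by (rule isCont_tendsto_compose)
  hence "(\<lambda>N. q ^ N * euler_log_deriv q (q ^ N * u)) \<longlonglongrightarrow> 0 * (deriv (euler_fun q) 0 / 1)"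
    unfolding euler_log_deriv_def
    by (intro tendsto_intros euler_fun_tendsto_1 LIMSEQ_power_zero q) auto
  hence "(\<lambda>N. euler_log_deriv q u - q ^ N * euler_log_deriv q (q ^ N * u)) \<longlonglongrightarrow> euler_log_deriv q u - 0"
    by (intro tendsto_intros) auto
  moreover have "euler_log_deriv q u - q ^ N * euler_log_deriv q (q ^ N * u) =
                   (\<Sum>n<N. - (q ^ n) / (1 - q ^ n * u))" for N
    by (subst partial[of N]) simp
  ultimately show ?thesis
    unfolding sums_def by simp
qed

text \<open>
  The denominators tend to \<open>1\<close>, so the terms are dominated by a geometric series.
\<close>

lemma euler_log_deriv_has_sum:
  assumes q: "norm q < 1" and nz: "euler_fun q u \<noteq> 0"
  shows "((\<lambda>n. - (q ^ n) / (1 - q ^ n * u)) has_sum euler_log_deriv q u) UNIV"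
proof (rule norm_summable_imp_has_sum)
  have "(\<lambda>n. 1 - q ^ n * u) \<longlonglongrightarrow> 1 - 0 * u"
    using q by (intro tendsto_intros LIMSEQ_power_zero)
  hence "(\<lambda>n. norm (1 - q ^ n * u)) \<longlonglongrightarrow> 1"
    using tendsto_norm by fastforce
  hence ev: "eventually (\<lambda>n. norm (1 - q ^ n * u) > 1 / 2) sequentially"
    by (rule order_tendstoD) auto
  show "summable (\<lambda>n. norm (- (q ^ n) / (1 - q ^ n * u)))"
  proof (rule summable_comparison_test_ev)
    show "eventually (\<lambda>n. norm (norm (- (q ^ n) / (1 - q ^ n * u))) \<le> 2 * norm q ^ n) sequentially"
      using ev
    proof eventually_elim
      case (elim n)
      have "norm q ^ n / norm (1 - q ^ n * u) \<le> norm q ^ n / (1 / 2)"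
        using elim by (intro divide_left_mono) auto
      thus ?case by (simp add: norm_divide norm_power)
    qed
    show "summable (\<lambda>n. 2 * norm q ^ n)"
      using q by (intro summable_mult summable_geometric) auto
  qed
qed (rule euler_log_deriv_sums[OF assms])

section \<open>The theta function\<close>

lemma euler_factor_series:
  assumes q: "norm q < 1" and \<kappa>: "\<kappa> = \<i> \<or> \<kappa> = -\<i>"
  assumes nz: "\<And>x. x \<in> S \<Longrightarrow> euler_fun q (c * exp (- 2 * \<kappa> * x)) \<noteq> 0"
  shows "factor_series_on S
           (\<lambda>x. - 2 * \<kappa> * (c * exp (- 2 * \<kappa> * x)) * euler_log_deriv q (c * exp (- 2 * \<kappa> * x)))"
proof -
  have "((\<lambda>n. log_deriv_term 1 \<kappa> (q ^ n * c) x) has_sum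
          - 2 * \<kappa> * (c * exp (- 2 * \<kappa> * x)) * euler_log_deriv q (c * exp (- 2 * \<kappa> * x))) UNIV"
    if "x \<in> S" for x
  proof -
    define v where "v = c * exp (- 2 * \<kappa> * x)"
    have "log_deriv_term 1 \<kappa> (q ^ n * c) x = - 2 * \<kappa> * v * (- (q ^ n) / (1 - q ^ n * v))" for n
      by (simp add: log_deriv_term_def v_def mult_ac)
    thus ?thesis
      unfolding v_def [symmetric]
      by (simp only:) (intro has_sum_cmult_right euler_log_deriv_has_sum q, use nz that v_def in auto)
  qed
  moreover have "q ^ n * c * exp (- 2 * \<kappa> * x) \<noteq> 1" if "x \<in> S" for x n
    using nz[OF that] euler_fun_eq_0_iff[OF q] by (auto simp: mult.assoc)
  ultimately show ?thesis
    unfolding factor_series_on_def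
    by (intro exI[of _ "\<lambda>_. 1"] exI[of _ "\<lambda>_. \<kappa>"] exI[of _ "\<lambda>n. q ^ n * c"]) (use \<kappa> in auto)
qed

text \<open>
  This is the square of the classical nome \<open>exp(\<pi>\<i>t)\<close>; multiplication of \<open>exp(2\<i>x)\<close> by it is
  translation of \<open>x\<close> by \<open>\<pi>t\<close>.
\<close>

definition nome :: "complex \<Rightarrow> complex" where
  "nome t = exp (2 * \<i> * (of_real pi * t))"

text \<open>
  Up to an exponential factor and a constant this is the Jacobi function \<open>\<theta>\<^sub>1\<close>. The missing exponential
  factor makes \<open>\<pi>\<close> a genuine period.
\<close>

definition theta :: "complex \<Rightarrow> complex \<Rightarrow> complex" where
  "theta t x = euler_fun (nome t) (exp (2 * \<i> * x)) * euler_fun (nome t) (nome t * exp (- 2 * \<i> * x))"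

lemma norm_nome: "Im t > 0 \<Longrightarrow> norm (nome t) < 1"
  by (simp add: nome_def norm_exp_eq_Re)

lemma exp_2i_eq_1_iff: "exp (2 * \<i> * z) = 1 \<longleftrightarrow> (\<exists>k::int. z = of_int k * of_real pi)"
proof -
  have "exp (2 * \<i> * z) = 1 \<longleftrightarrow> (\<exists>k::int. 2 * \<i> * z = 2 * \<i> * (of_int k * of_real pi))"
    using exp_eq[of "2 * \<i> * z" 0] by (simp add: mult_ac)
  thus ?thesis
    by simp
qed

context
  fixes t :: complex
  assumes t: "Im t > 0"
begin

lemma theta_holomorphic: "theta t holomorphic_on A"
  unfolding theta_def by (intro holomorphic_intros norm_nome t)

lemma theta_has_derivative: "(theta t has_field_derivative deriv (theta t) x) (at x)"
  by (rule holomorphic_derivI[OF theta_holomorphic open_UNIV UNIV_I])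

lemma theta_plus_pi: "theta t (x + of_real pi) = theta t x"
proof -
  have "exp (2 * \<i> * (x + of_real pi)) = exp (2 * \<i> * x)" "exp (- 2 * \<i> * (x + of_real pi)) = exp (- 2 * \<i> * x)"
    by (auto simp: exp_eq algebra_simps intro: exI[of _ "1::int"] exI[of _ "-1::int"])
  thus ?thesis
    by (simp only: theta_def)
qed

lemma theta_plus_period: "theta t (x + of_real pi * t) = - exp (- 2 * \<i> * x) * theta t x"
proof -
  define u where "u = exp (2 * \<i> * x)"
  define q where "q = nome t"
  have [simp]: "u \<noteq> 0" "q \<noteq> 0" and q1: "norm q < 1"
    using norm_nome[OF t] by (auto simp: u_def q_def nome_def)
  have "exp (2 * \<i> * (x + of_real pi * t)) = q * u"
    by (simp add: q_def u_def nome_def mult_exp_exp algebra_simps)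
  moreover have "q * exp (- 2 * \<i> * (x + of_real pi * t)) = inverse u"
    by (simp add: q_def u_def nome_def mult_exp_exp algebra_simps flip: exp_minus)
  moreover have inv: "exp (- 2 * \<i> * x) = inverse u"
    by (simp add: u_def flip: exp_minus)
  ultimately have "theta t (x + of_real pi * t) = euler_fun q (q * u) * euler_fun q (inverse u)"
    by (simp add: theta_def q_def)
  also have "euler_fun q (inverse u) = (1 - inverse u) * euler_fun q (q * inverse u)"
    by (rule euler_fun_rec[OF q1])
  also have "euler_fun q (q * u) * ((1 - inverse u) * euler_fun q (q * inverse u)) =
               - inverse u * ((1 - u) * euler_fun q (q * u) * euler_fun q (q * inverse u))"
    by (simp add: field_simps)
  also have "(1 - u) * euler_fun q (q * u) = euler_fun q u"
    by (rule euler_fun_rec[OF q1, symmetric])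
  also have "euler_fun q u * euler_fun q (q * inverse u) = theta t x"
    unfolding theta_def inv q_def [symmetric] u_def [symmetric] ..
  finally show ?thesis
    using inv by simp
qed

lemma theta_eq_0_iff:
  "theta t x = 0 \<longleftrightarrow> (\<exists>m n::int. x = of_int m * of_real pi + of_int n * (of_real pi * t))"
proof -
  note q = norm_nome[OF t]
  have "nome t ^ n * exp (2 * \<i> * x) = exp (2 * \<i> * (of_nat n * (of_real pi * t) + x))" for n
    by (simp add: nome_def mult_exp_exp ring_distribs mult_ac add_ac flip: exp_of_nat_mult)
  hence 1: "euler_fun (nome t) (exp (2 * \<i> * x)) = 0 \<longleftrightarrow>
              (\<exists>n k. of_nat n * (of_real pi * t) + x = of_int k * of_real pi)"
    by (simp add: euler_fun_eq_0_iff[OF q] exp_2i_eq_1_iff)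
  have "nome t ^ n * (nome t * exp (- 2 * \<i> * x)) = exp (2 * \<i> * (of_nat (Suc n) * (of_real pi * t) - x))" for n
    by (simp add: nome_def mult_exp_exp algebra_simps flip: exp_of_nat_mult)
  hence 2: "euler_fun (nome t) (nome t * exp (- 2 * \<i> * x)) = 0 \<longleftrightarrow>
              (\<exists>n k. of_nat (Suc n) * (of_real pi * t) - x = of_int k * of_real pi)"
    by (simp only: euler_fun_eq_0_iff[OF q] exp_2i_eq_1_iff)
  show ?thesis
  proof
    assume "theta t x = 0"
    then consider n k where "of_nat n * (of_real pi * t) + x = of_int k * of_real pi"
      | n k where "of_nat (Suc n) * (of_real pi * t) - x = of_int k * of_real pi"
      using 1 2 by (auto simp: theta_def)
    thus "\<exists>m n::int. x = of_int m * of_real pi + of_int n * (of_real pi * t)"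
    proof cases
      case (1 n k)
      hence "x = of_int k * of_real pi + of_int (- int n) * (of_real pi * t)"
        by (simp add: algebra_simps)
      thus ?thesis by blast
    next
      case (2 n k)
      hence "x = of_int (- k) * of_real pi + of_int (int (Suc n)) * (of_real pi * t)"
        by (simp add: algebra_simps)
      thus ?thesis by blast
    qed
  next
    assume "\<exists>m n::int. x = of_int m * of_real pi + of_int n * (of_real pi * t)"
    then obtain m n :: int where x: "x = of_int m * of_real pi + of_int n * (of_real pi * t)"
      by blast
    show "theta t x = 0"
    proof (cases "n > 0")
      case True
      hence "n = int (Suc (nat n - 1))" by simp
      hence "of_nat (Suc (nat n - 1)) * (of_real pi * t) - x = of_int (- m) * of_real pi"
        using x by (metis add_diff_cancel_right' minus_diff_eq mult_minus_left of_int_minus of_int_of_nat_eq)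
      hence "euler_fun (nome t) (nome t * exp (- 2 * \<i> * x)) = 0"
        using 2 by blast
      thus ?thesis by (simp add: theta_def)
    next
      case False
      hence "of_nat (nat (- n)) = (- of_int n :: complex)"
        by (metis of_int_minus of_int_of_nat_eq int_nat_eq neg_0_le_iff_le not_less)
      hence "of_nat (nat (- n)) * (of_real pi * t) + x = of_int m * of_real pi"
        using x by (simp add: algebra_simps)
      hence "euler_fun (nome t) (exp (2 * \<i> * x)) = 0"
        using 1 by blast
      thus ?thesis by (simp add: theta_def)
    qed
  qed
qed

text \<open>
  Splitting off the factor \<open>1 - exp(2\<i>x)\<close> leaves a function \<open>R\<close> with \<open>R 0 \<noteq> 0\<close>.
\<close>

lemma theta_deriv_at_0: "deriv (theta t) 0 \<noteq> 0"
proof -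
  define q where "q = nome t"
  note q = norm_nome[OF t, folded q_def]
  define R where "R = (\<lambda>x. euler_fun q (q * exp (2 * \<i> * x)) * euler_fun q (q * exp (- 2 * \<i> * x)))"
  have "R holomorphic_on UNIV"
    unfolding R_def by (intro holomorphic_intros q)
  hence R': "(R has_field_derivative deriv R 0) (at 0)"
    by (rule holomorphic_derivI) auto
  have "((\<lambda>x. (1 - exp (2 * \<i> * x)) * R x) has_field_derivative (- 2 * \<i>) * R 0) (at 0)"
    by (rule derivative_eq_intros R' refl | simp)+
  also have "(\<lambda>x. (1 - exp (2 * \<i> * x)) * R x) = theta t"
    unfolding theta_def R_def q_def [symmetric]
    by (rule ext, subst (3) euler_fun_rec[OF q]) simp
  finally have "deriv (theta t) 0 = (- 2 * \<i>) * R 0"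
    by (rule DERIV_imp_deriv)
  moreover have "R 0 \<noteq> 0"
    using power_Suc_neq_1[OF q] by (simp add: R_def euler_fun_eq_0_iff[OF q] mult.commute)
  ultimately show ?thesis
    by simp
qed

lemma theta_deriv_plus_pi: "deriv (theta t) (x + of_real pi) = deriv (theta t) x"
proof -
  have "((\<lambda>x. theta t (x + of_real pi)) has_field_derivative deriv (theta t) (x + of_real pi)) (at x)"
    by (rule DERIV_shift[THEN iffD1, OF theta_has_derivative])
  thus ?thesis
    using theta_has_derivative DERIV_unique unfolding theta_plus_pi by blast
qed

lemma theta_deriv_plus_period:
  assumes "theta t x = 0"
  shows "deriv (theta t) (x + of_real pi * t) = - exp (- 2 * \<i> * x) * deriv (theta t) x"
proof -
  have "((\<lambda>x. theta t (x + of_real pi * t)) has_field_derivative deriv (theta t) (x + of_real pi * t)) (at x)"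
    by (rule DERIV_shift[THEN iffD1, OF theta_has_derivative])
  moreover have "((\<lambda>x. - exp (- 2 * \<i> * x) * theta t x) has_field_derivative
                   - exp (- 2 * \<i> * x) * deriv (theta t) x) (at x)"
    by (rule derivative_eq_intros theta_has_derivative refl | simp add: assms)+
  ultimately show ?thesis
    using DERIV_unique unfolding theta_plus_period by blast
qed

text \<open>
  The two translation laws carry simplicity from the zero at \<open>0\<close> to every lattice point.
\<close>

lemma theta_simple_zeros:
  assumes "theta t x = 0"
  shows "deriv (theta t) x \<noteq> 0"
proof -
  define simple where "simple = (\<lambda>x. theta t x = 0 \<and> deriv (theta t) x \<noteq> 0)"
  obtain m n :: int where x: "x = of_int m * of_real pi + of_int n * (of_real pi * t)"
    using assms theta_eq_0_iff by blast
  have shift1: "simple (z + of_real pi) \<longleftrightarrow> simple z" for z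
    by (simp add: simple_def theta_plus_pi theta_deriv_plus_pi)
  have shift2: "simple (z + of_real pi * t) \<longleftrightarrow> simple z" for z
    using theta_deriv_plus_period[of z] by (auto simp: simple_def theta_plus_period)
  have "simple (of_int m * of_real pi)"
  proof (induction m rule: int_induct[of _ 0])
    case base
    show ?case using theta_deriv_at_0 theta_eq_0_iff[of 0] by (auto simp: simple_def intro: exI[of _ 0])
  next
    case (step1 i)
    thus ?case using shift1[of "of_int i * of_real pi"] by (simp add: algebra_simps)
  next
    case (step2 i)
    thus ?case using shift1[of "of_int (i - 1) * of_real pi"] by (simp add: algebra_simps)
  qed
  hence "simple (of_int m * of_real pi + of_int n * (of_real pi * t))"
  proof (induction n rule: int_induct[of _ 0])
    case (step1 i)
    thus ?case using shift2[of "of_int m * of_real pi + of_int i * (of_real pi * t)"]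
      by (simp add: algebra_simps)
  next
    case (step2 i)
    thus ?case using shift2[of "of_int m * of_real pi + of_int (i - 1) * (of_real pi * t)"]
      by (simp add: algebra_simps)
  qed simp
  thus ?thesis
    by (simp add: simple_def x)
qed

lemma zorder_theta: "zorder (theta t) x = (if theta t x = 0 then 1 else 0)"
proof -
  have an: "theta t analytic_on {x}"
    using theta_holomorphic[of UNIV] by (meson UNIV_I analytic_at open_UNIV)
  show ?thesis
    using zorder_zero_eqI'[OF an, of 1] zorder_eq_0I[OF an] theta_simple_zeros[of x] by auto
qed

lemma theta_log_deriv:
  assumes "theta t x \<noteq> 0"
  defines "u \<equiv> exp (2 * \<i> * x)" and "v \<equiv> nome t * exp (- 2 * \<i> * x)"
  shows "deriv (theta t) x / theta t x =
           2 * \<i> * u * euler_log_deriv (nome t) u - 2 * \<i> * v * euler_log_deriv (nome t) v"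
proof -
  note q = norm_nome[OF t]
  have nz: "euler_fun (nome t) u \<noteq> 0" "euler_fun (nome t) v \<noteq> 0"
    using assms by (auto simp: theta_def)
  have "(theta t has_field_derivative
          deriv (euler_fun (nome t)) u * (2 * \<i> * u) * euler_fun (nome t) v +
          euler_fun (nome t) u * (deriv (euler_fun (nome t)) v * (- 2 * \<i> * v))) (at x)"
    unfolding theta_def u_def v_def
    by (rule derivative_eq_intros DERIV_chain2[OF euler_fun_has_derivative[OF q]] refl | simp)+
  hence "deriv (theta t) x = deriv (euler_fun (nome t)) u * (2 * \<i> * u) * euler_fun (nome t) v +
          euler_fun (nome t) u * (deriv (euler_fun (nome t)) v * (- 2 * \<i> * v))"
    by (rule DERIV_imp_deriv)
  moreover have "theta t x = euler_fun (nome t) u * euler_fun (nome t) v"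
    by (simp add: theta_def u_def v_def)
  ultimately show ?thesis
    using nz by (simp add: euler_log_deriv_def add_divide_distrib diff_divide_distrib mult_ac)
qed

text \<open>
  The two Euler functions contribute the terms with \<open>\<kappa> = -\<i>\<close> and with \<open>\<kappa> = \<i>\<close>.
\<close>

lemma factor_series_on_theta:
  assumes "\<And>x. x \<in> S \<Longrightarrow> theta t (x - a) \<noteq> 0"
  shows "factor_series_on S (\<lambda>x. deriv (theta t) (x - a) / theta t (x - a))"
proof -
  define q where "q = nome t"
  define u v where "u = (\<lambda>x. exp (- 2 * \<i> * a) * exp (- 2 * (-\<i>) * x))"
    and "v = (\<lambda>x. nome t * exp (2 * \<i> * a) * exp (- 2 * \<i> * x))"
  have u: "exp (2 * \<i> * (x - a)) = u x" and v: "nome t * exp (- 2 * \<i> * (x - a)) = v x" for x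
    unfolding u_def v_def mult.assoc[of "nome t"] mult_exp_exp by (simp_all add: algebra_simps)
  have nz: "euler_fun q (u x) \<noteq> 0" "euler_fun q (v x) \<noteq> 0" if "x \<in> S" for x
    using assms[OF that] unfolding theta_def u v q_def by auto
  have "factor_series_on S (\<lambda>x. - 2 * (-\<i>) * u x * euler_log_deriv q (u x))"
    unfolding u_def
    by (rule euler_factor_series) (use norm_nome[OF t] nz(1)[unfolded u_def] in \<open>auto simp: q_def\<close>)
  moreover have "factor_series_on S (\<lambda>x. - 2 * \<i> * v x * euler_log_deriv q (v x))"
    unfolding v_def
    by (rule euler_factor_series) (use norm_nome[OF t] nz(2)[unfolded v_def] in \<open>auto simp: q_def\<close>)
  ultimately have "factor_series_on S (\<lambda>x. - 2 * (-\<i>) * u x * euler_log_deriv q (u x) +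
                                 - 2 * \<i> * v x * euler_log_deriv q (v x))"
    by (rule factor_series_on_add)
  also have "?this \<longleftrightarrow> ?thesis"
  proof (rule factor_series_on_cong)
    fix x assume "x \<in> S"
    show "- 2 * (-\<i>) * u x * euler_log_deriv q (u x) + - 2 * \<i> * v x * euler_log_deriv q (v x) =
            deriv (theta t) (x - a) / theta t (x - a)"
      using theta_log_deriv[OF assms[OF \<open>x \<in> S\<close>]] unfolding u v by (simp add: q_def)
  qed
  finally show ?thesis .
qed

end

section \<open>Period lattice and quasi-periodic functions\<close>

lemma periodic_add_of_int_mult:
  fixes g :: "complex \<Rightarrow> 'a"
  assumes "\<And>x. g (x + p) = g x"
  shows "g (x + of_int m * p) = g x"
proof (induction m rule: int_induct[of _ 0])
  case (step1 i)
  thus ?case using assms[of "x + of_int i * p"] by (simp add: algebra_simps)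
next
  case (step2 i)
  thus ?case using assms[of "x + of_int (i - 1) * p"] by (simp add: algebra_simps)
qed simp

definition lattice_point :: "complex \<Rightarrow> int \<Rightarrow> int \<Rightarrow> complex" where
  "lattice_point t m n = of_int m * of_real pi + of_int n * (of_real pi * t)"

definition cell_point :: "complex \<Rightarrow> real \<Rightarrow> real \<Rightarrow> complex" where
  "cell_point t r s = of_real r * of_real pi + of_real s * (of_real pi * t)"

text \<open>
  The cell is half open, so that it contains exactly one point of each lattice coset.
\<close>

definition period_cell :: "complex \<Rightarrow> complex set" where
  "period_cell t = {cell_point t r s |r s. 0 \<le> r \<and> r < 1 \<and> 0 \<le> s \<and> s < 1}"

lemma period_cell_subset_compact:
  obtains K where "compact K" "period_cell t \<subseteq> K"
proof
  have "continuous_on ({0..1} \<times> {0..1}) (\<lambda>p. cell_point t (fst p) (snd p))"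
    unfolding cell_point_def by (intro continuous_intros)
  thus "compact ((\<lambda>p. cell_point t (fst p) (snd p)) ` ({0..1} \<times> {0..1}))"
    by (rule compact_continuous_image) (intro compact_Times compact_Icc)
  show "period_cell t \<subseteq> (\<lambda>p. cell_point t (fst p) (snd p)) ` ({0..1} \<times> {0..1})"
    unfolding period_cell_def by force
qed

lemma cell_point_eq_iff:
  assumes "Im t > 0"
  shows "cell_point t r s = cell_point t r' s' \<longleftrightarrow> r = r' \<and> s = s'"
  using assms by (auto simp: cell_point_def complex_eq_iff)

lemma cell_point_add_lattice_point:
  "cell_point t r s + lattice_point t m n = cell_point t (r + of_int m) (s + of_int n)"
  by (simp add: cell_point_def lattice_point_def algebra_simps)

lemma cell_point_surj:
  assumes "Im t > 0"
  obtains r s where "z = cell_point t r s"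
proof
  define s where "s = Im z / (pi * Im t)"
  define r where "r = (Re z - s * pi * Re t) / pi"
  show "z = cell_point t r s"
    using assms by (simp add: cell_point_def complex_eq_iff s_def) (simp add: r_def s_def)
qed

lemma period_cell_representative:
  assumes "Im t > 0"
  obtains b m n where "b \<in> period_cell t" "z = b + lattice_point t m n"
proof -
  obtain r s where z: "z = cell_point t r s"
    using cell_point_surj[OF assms] .
  have "cell_point t (frac r) (frac s) \<in> period_cell t"
    unfolding period_cell_def using frac_ge_0 frac_lt_1 by blast
  moreover have "z = cell_point t (frac r) (frac s) + lattice_point t \<lfloor>r\<rfloor> \<lfloor>s\<rfloor>"
    by (simp add: cell_point_add_lattice_point z frac_def)
  ultimately show ?thesis
    using that by blast
qed

lemma period_cell_unique:
  assumes t: "Im t > 0" and "a \<in> period_cell t" "b \<in> period_cell t" "b = a + lattice_point t m n"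
  shows "a = b"
proof -
  from assms(2) obtain r s where a: "a = cell_point t r s" "0 \<le> r" "r < 1" "0 \<le> s" "s < 1"
    unfolding period_cell_def by blast
  from assms(3) obtain r' s' where b: "b = cell_point t r' s'" "0 \<le> r'" "r' < 1" "0 \<le> s'" "s' < 1"
    unfolding period_cell_def by blast
  have "r' = r + of_int m" "s' = s + of_int n"
    using assms(4) unfolding a(1) b(1) cell_point_add_lattice_point cell_point_eq_iff[OF t] by auto
  moreover from this have "m = 0" "n = 0"
    using a b by linarith+
  ultimately show ?thesis
    using a b by simp
qed

lemma doubly_periodic_add_lattice_point:
  fixes g :: "complex \<Rightarrow> 'a"
  assumes "\<And>x. g (x + of_real pi) = g x" "\<And>x. g (x + of_real pi * t) = g x"
  shows "g (x + lattice_point t m n) = g x"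
  using periodic_add_of_int_mult[of g "of_real pi" x m, OF assms(1)]
        periodic_add_of_int_mult[of g "of_real pi * t" "x + of_int m * of_real pi" n, OF assms(2)]
  by (simp add: lattice_point_def add.assoc)

lemma doubly_periodic_entire_constant:
  assumes t: "Im t > 0" and g: "g holomorphic_on UNIV"
  assumes "\<And>x. g (x + of_real pi) = g x" "\<And>x. g (x + of_real pi * t) = g x"
  shows "g x = g 0"
proof -
  obtain K where K: "compact K" "period_cell t \<subseteq> K"
    using period_cell_subset_compact .
  have "range g \<subseteq> g ` K"
  proof safe
    fix z
    obtain b m n where "b \<in> period_cell t" "z = b + lattice_point t m n"
      using period_cell_representative[OF t] .
    thus "g z \<in> g ` K"
      using doubly_periodic_add_lattice_point[OF assms(3,4)] K(2) by auto
  qed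
  moreover have "compact (g ` K)"
    using g K(1) holomorphic_on_imp_continuous_on holomorphic_on_subset
    by (intro compact_continuous_image) blast+
  ultimately have "bounded (range g)"
    using bounded_subset compact_imp_bounded by blast
  thus ?thesis
    using Liouville_theorem[OF g] unfolding constant_on_def by auto
qed

lemma entire_deriv_0_constant:
  assumes "\<And>x. (g has_field_derivative 0) (at x)"
  shows "g x = (g 0 :: complex)"
proof -
  have "\<exists>c. \<forall>x\<in>UNIV. g x = c"
    using assms by (intro has_field_derivative_zero_constant) auto
  thus ?thesis by auto
qed

text \<open>
  The multiplier \<open>exp(c + Nx)\<close> adds the constant \<open>N\<close> to \<open>H'/H\<close> under translation by \<open>\<pi>t\<close>, so the
  derivative of \<open>H'/H\<close> is doubly periodic and entire, hence constant. Thus \<open>H'/H\<close> is affine linear,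
  and being periodic it is a constant \<open>\<beta>\<close>; finally \<open>H(\<pi>) = H(0)\<close> gives \<open>exp(\<beta>\<pi>) = 1\<close>.
\<close>

lemma quasi_periodic_nonvanishing_exponential:
  assumes t: "Im t > 0" and H: "H holomorphic_on UNIV" "\<And>x. H x \<noteq> 0"
  assumes per: "\<And>x. H (x + of_real pi) = H x" "\<And>x. H (x + of_real pi * t) = exp (c + N * x) * H x"
  obtains k :: int where "\<And>x. H x = H 0 * exp (2 * \<i> * of_int k * x)"
proof -
  have H': "(H has_field_derivative deriv H x) (at x)" for x
    by (rule holomorphic_derivI[OF H(1)]) auto
  define D where "D = (\<lambda>x. deriv H x / H x)"
  have D_holo: "D holomorphic_on UNIV"
    unfolding D_def by (intro holomorphic_intros H holomorphic_deriv) auto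
  have D': "(D has_field_derivative deriv D x) (at x)" for x
    by (rule holomorphic_derivI[OF D_holo]) auto
  have D1: "D (x + of_real pi) = D x" for x
  proof -
    have "((\<lambda>x. H (x + of_real pi)) has_field_derivative deriv H (x + of_real pi)) (at x)"
      by (rule DERIV_shift[THEN iffD1, OF H'])
    hence "deriv H (x + of_real pi) = deriv H x"
      unfolding per using H' DERIV_unique by blast
    thus ?thesis by (simp add: D_def per)
  qed
  have D2: "D (x + of_real pi * t) = N + D x" for x
  proof -
    have "((\<lambda>x. H (x + of_real pi * t)) has_field_derivative deriv H (x + of_real pi * t)) (at x)"
      by (rule DERIV_shift[THEN iffD1, OF H'])
    moreover have "((\<lambda>x. exp (c + N * x) * H x) has_field_derivative
                     exp (c + N * x) * (N * H x + deriv H x)) (at x)"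
      by (rule derivative_eq_intros H' refl | simp add: algebra_simps)+
    ultimately have "deriv H (x + of_real pi * t) = exp (c + N * x) * (N * H x + deriv H x)"
      unfolding per using DERIV_unique by blast
    thus ?thesis using H(2)[of x] by (simp add: D_def per add_divide_distrib)
  qed
  have "deriv D (x + of_real pi) = deriv D x" for x
  proof -
    have "((\<lambda>x. D (x + of_real pi)) has_field_derivative deriv D (x + of_real pi)) (at x)"
      by (rule DERIV_shift[THEN iffD1, OF D'])
    thus ?thesis unfolding D1 using D' DERIV_unique by blast
  qed
  moreover have "deriv D (x + of_real pi * t) = deriv D x" for x
  proof -
    have "((\<lambda>x. D (x + of_real pi * t)) has_field_derivative deriv D (x + of_real pi * t)) (at x)"
      by (rule DERIV_shift[THEN iffD1, OF D'])
    moreover have "((\<lambda>x. N + D x) has_field_derivative deriv D x) (at x)"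
      by (rule derivative_eq_intros D' refl | simp)+
    ultimately show ?thesis unfolding D2 using DERIV_unique by blast
  qed
  moreover have "deriv D holomorphic_on UNIV"
    by (intro holomorphic_deriv D_holo) auto
  ultimately have const: "deriv D x = deriv D 0" for x
    by (intro doubly_periodic_entire_constant[OF t])
  define \<alpha> where "\<alpha> = deriv D 0"
  have "((\<lambda>x. D x - \<alpha> * x) has_field_derivative 0) (at x)" for x
    by (rule derivative_eq_intros D' refl | simp add: const[of x] \<alpha>_def)+
  hence D_lin: "D x - \<alpha> * x = D 0 - \<alpha> * 0" for x
    by (rule entire_deriv_0_constant)
  have "\<alpha> = 0"
    using D_lin[of "of_real pi"] D1[of 0] by simp
  define \<beta> where "\<beta> = D 0"
  have dH: "deriv H x = \<beta> * H x" for x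
    using D_lin[of x] H(2)[of x] by (simp add: \<open>\<alpha> = 0\<close> \<beta>_def D_def field_simps)
  have "((\<lambda>x. H x * exp (- \<beta> * x)) has_field_derivative 0) (at x)" for x
    by (rule derivative_eq_intros H' refl | simp add: dH)+
  hence "H x * exp (- \<beta> * x) = H 0 * exp (- \<beta> * 0)" for x
    by (rule entire_deriv_0_constant)
  hence quot: "H x * exp (- \<beta> * x) = H 0" for x
    by simp
  have H_eq: "H x = H 0 * exp (\<beta> * x)" for x
  proof -
    have "H x = H x * exp (- \<beta> * x) * exp (\<beta> * x)"
      by (simp add: mult.assoc mult_exp_exp)
    thus ?thesis
      by (simp only: quot)
  qed
  have "exp (2 * \<i> * (\<beta> * of_real pi / (2 * \<i>))) = 1"
    using H_eq[of "of_real pi"] per(1)[of 0] H(2)[of 0] by simp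
  then obtain k :: int where "\<beta> * of_real pi / (2 * \<i>) = of_int k * of_real pi"
    unfolding exp_2i_eq_1_iff by blast
  hence "\<beta> = 2 * \<i> * of_int k"
    by (simp add: field_simps)
  from H_eq [unfolded this] show ?thesis
    by (rule that)
qed

section \<open>Orders of zeros and products of theta functions\<close>

text \<open>
  A quotient of meromorphic functions with cancelling zeros and poles has unrelated values at the
  cancelled points; \<^const>\<open>remove_sings\<close> repairs them.
\<close>

lemma remove_sings_nonvanishing:
  assumes mero: "f meromorphic_on {z}" and ord: "zorder f z = 0"
    and nz: "eventually (\<lambda>w. f w \<noteq> 0) (at z)"
  shows "remove_sings f analytic_on {z}" "remove_sings f z \<noteq> 0" "f \<midarrow>z\<rightarrow> remove_sings f z"
proof -
  have iso: "isolated_singularity_at f z" "not_essential f z"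
    using mero by (simp_all add: meromorphic_at_iff)
  have "\<not> is_pole f z"
    using isolated_pole_imp_neg_zorder[OF iso(1)] ord by auto
  then obtain c where c: "f \<midarrow>z\<rightarrow> c"
    using iso(2) unfolding not_essential_def by blast
  thus lim: "f \<midarrow>z\<rightarrow> remove_sings f z"
    using remove_sings_eqI by blast
  show an: "remove_sings f analytic_on {z}"
    using remove_sings_analytic_at[OF iso(1) c] .
  have ev: "eventually (\<lambda>w. remove_sings f w = f w) (at z)"
    using iso(1) by (rule eventually_remove_sings_eq_at)
  have "zorder (remove_sings f) z = 0"
    using zorder_cong[OF ev refl] ord by simp
  moreover have "frequently (\<lambda>w. remove_sings f w \<noteq> 0) (at z)"
    by (rule eventually_frequently) (use ev nz in \<open>auto elim: eventually_elim2\<close>)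
  ultimately show "remove_sings f z \<noteq> 0"
    using zorder_eq_0_iff[OF an] by blast
qed

lemma zorder_translate: "zorder (\<lambda>x. f (x - a)) z = zorder f (z - a)"
  unfolding zorder_shift[of "\<lambda>x. f (x - a)" z] zorder_shift[of f "z - a"]
  by (simp add: add_diff_eq)

lemma theta_product_derivative:
  assumes t: "Im t > 0" and R: "\<And>a. a \<in> R \<Longrightarrow> theta t (x - a) \<noteq> 0"
  shows "((\<lambda>x. \<Prod>a\<in>R. theta t (x - a) powi m a) has_field_derivative
           (\<Prod>a\<in>R. theta t (x - a) powi m a) *
           (\<Sum>a\<in>R. of_int (m a) * (deriv (theta t) (x - a) / theta t (x - a)))) (at x)"
proof -
  have d: "((\<lambda>x. theta t (x - a)) has_field_derivative deriv (theta t) (x - a)) (at x)" for a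
    using DERIV_shift[THEN iffD1, of "theta t" _ x "- a"] theta_has_derivative[OF t] by simp
  have "((\<lambda>x. \<Prod>a\<in>R. theta t (x - a) powi m a) has_field_derivative
           (\<Prod>a\<in>R. theta t (x - a) powi m a) *
           (\<Sum>a\<in>R. (of_int (m a) * theta t (x - a) powi (m a - 1) * deriv (theta t) (x - a)) /
                     theta t (x - a) powi m a)) (at x)"
    by (rule has_field_derivative_prod') (use R in \<open>auto intro!: DERIV_power_int d\<close>)
  also have "(\<Sum>a\<in>R. (of_int (m a) * theta t (x - a) powi (m a - 1) * deriv (theta t) (x - a)) /
                     theta t (x - a) powi m a) =
             (\<Sum>a\<in>R. of_int (m a) * (deriv (theta t) (x - a) / theta t (x - a)))"
    by (intro sum.cong refl) (use R in \<open>simp add: power_int_diff\<close>)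
  finally show ?thesis .
qed

text \<open>
  The sign \<open>-1\<close> of each translation factor is written as \<open>exp(\<i>\<pi>)\<close>, so that the whole multiplier
  becomes one exponential of an affine linear function of \<open>x\<close>.
\<close>

lemma theta_product_quasi_periodic:
  assumes t: "Im t > 0"
  shows "(\<Prod>a\<in>R. theta t (x + of_real pi * t - a) powi m a) =
           exp ((\<Sum>a\<in>R. of_int (m a) * (\<i> * of_real pi + 2 * \<i> * a)) + (\<Sum>a\<in>R. - 2 * \<i> * of_int (m a)) * x) *
           (\<Prod>a\<in>R. theta t (x - a) powi m a)"
proof -
  have fac: "theta t (x + of_real pi * t - a) powi m a =
               exp (of_int (m a) * (\<i> * of_real pi + 2 * \<i> * a) + - 2 * \<i> * of_int (m a) * x) *
               theta t (x - a) powi m a" for a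
  proof -
    have "theta t (x + of_real pi * t - a) = - exp (- 2 * \<i> * (x - a)) * theta t (x - a)"
      using theta_plus_period[OF t, of "x - a"] by (simp add: algebra_simps)
    also have "- exp (- 2 * \<i> * (x - a)) = exp (\<i> * of_real pi + - 2 * \<i> * (x - a))"
      by (simp only: exp_add exp_pi_i') simp
    finally have "theta t (x + of_real pi * t - a) powi m a =
        exp (\<i> * of_real pi + - 2 * \<i> * (x - a)) powi m a * theta t (x - a) powi m a"
      by (simp only: power_int_mult_distrib)
    thus ?thesis
      by (simp add: exp_power_int algebra_simps)
  qed
  show ?thesis
  proof (cases "finite R")
    case True
    show ?thesis
      unfolding fac prod.distrib exp_sum[OF True, symmetric] sum.distrib sum_distrib_right ..
  qed simp
qed

section \<open>Factorization of elliptic functions\<close>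

text \<open>
  The factorization \<open>f(x) = c exp(2\<i>kx) \<Prod> \<theta>(x - a) powi m a\<close> is established on \<open>S\<close> and differentiated
  logarithmically. If \<open>S\<close> is empty, as for \<open>f = 0\<close>, there is nothing to sum.
\<close>

lemma doubly_periodic_log_deriv_factor_series:
  assumes t: "Im t > 0" and mero: "f meromorphic_on UNIV"
  assumes per: "\<And>x. f (x + of_real pi) = f x" "\<And>x. f (x + of_real pi * t) = f x"
  defines "S \<equiv> {x. f analytic_on {x} \<and> f x \<noteq> 0}"
  shows "factor_series_on S (\<lambda>x. deriv f x / f x)"
proof (cases "S = {}")
  case True
  thus ?thesis
    using factor_series_on_0[of S] by (simp add: factor_series_on_def)
next
  case False
  then obtain x0 where x0: "f analytic_on {x0}" "f x0 \<noteq> 0"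
    unfolding S_def by blast
  \<comment> \<open>By the identity theorem one point of \<open>S\<close> suffices to make \<open>S\<close> the complement of a sparse set.\<close>
  have "\<not> eventually (\<lambda>z. f z = 0) (cosparse UNIV)"
  proof
    assume "eventually (\<lambda>z. f z = 0) (cosparse UNIV)"
    hence "eventually (\<lambda>z. f z = 0) (at x0)"
      by (simp add: eventually_cosparse_open_eq)
    moreover have "eventually (\<lambda>z. f z \<noteq> 0) (at x0)"
      using analytic_at_neq_imp_eventually_neq[OF x0] .
    ultimately have "eventually (\<lambda>z. False) (at x0)"
      by eventually_elim simp
    thus False by simp
  qed
  hence "eventually (\<lambda>z. f z \<noteq> 0) (cosparse UNIV)"
    using meromorphic_imp_constant_or_avoid[OF mero, of 0] by auto
  with meromorphic_on_imp_analytic_cosparse[OF mero]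
  have S_cosparse: "eventually (\<lambda>z. z \<in> S) (cosparse UNIV)"
    unfolding S_def by (auto elim: eventually_elim2)
  hence ev_S: "eventually (\<lambda>w. w \<in> S) (at z)" for z
    by (simp add: eventually_cosparse_open_eq)

  define m where "m = (\<lambda>z. zorder f z)"
  have m_S: "m z = 0" if "z \<in> S" for z
    using that zorder_eq_0I unfolding S_def m_def by blast
  have m_lattice: "m (z + lattice_point t i j) = m z" for z i j
  proof -
    have "f (u + (z + lattice_point t i j)) = f (u + z)" for u
      using doubly_periodic_add_lattice_point[OF per, of "u + z" i j] by (simp add: add.assoc)
    thus ?thesis
      unfolding m_def zorder_shift[of f "z + _"] zorder_shift[of f z] by simp
  qed
  define R where "R = {a \<in> period_cell t. m a \<noteq> 0}"
  have fin: "finite R"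
  proof -
    obtain K where K: "compact K" "period_cell t \<subseteq> K"
      using period_cell_subset_compact .
    have "{z. z \<notin> S} sparse_in UNIV"
      using S_cosparse by (simp add: eventually_cosparse)
    hence "finite (K \<inter> {z. z \<notin> S})"
      using sparse_in_compact_finite[OF sparse_in_subset K(1)] by blast
    moreover have "R \<subseteq> K \<inter> {z. z \<notin> S}"
      unfolding R_def using K(2) m_S by auto
    ultimately show ?thesis
      by (rule finite_subset[rotated])
  qed

  \<comment> \<open>\<open>Pr\<close> has the same order as \<open>f\<close> at every point, because each point is congruent to exactly one point \<open>b\<close> of the cell.\<close>
  define Pr where "Pr = (\<lambda>x. \<Prod>a\<in>R. theta t (x - a) powi m a)"
  have theta_nz: "theta t (x - a) \<noteq> 0" if "x \<in> S" "a \<in> R" for x a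
  proof
    assume "theta t (x - a) = 0"
    then obtain i j where "x - a = lattice_point t i j"
      unfolding theta_eq_0_iff[OF t] lattice_point_def by blast
    hence "m x = m a"
      using m_lattice[of a i j] by (simp add: algebra_simps)
    thus False
      using that m_S[of x] by (simp add: R_def)
  qed
  have Pr_nz: "Pr x \<noteq> 0" if "x \<in> S" for x
    unfolding Pr_def using theta_nz[OF that] fin by auto
  have theta_an: "(\<lambda>x. theta t (x - a)) analytic_on A" for a A
  proof -
    have "(\<lambda>x. theta t (x - a)) holomorphic_on UNIV"
      by (rule holomorphic_on_compose_gen[OF _ theta_holomorphic[OF t], unfolded o_def])
         (auto intro!: holomorphic_intros)
    thus ?thesis
      using analytic_on_open[of UNIV] analytic_on_subset by blast
  qed
  have theta_mero: "(\<lambda>x. theta t (x - a) powi n) meromorphic_on A" for a n A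
    by (intro meromorphic_intros analytic_on_imp_meromorphic_on theta_an)
  have Pr_mero: "Pr meromorphic_on A" for A
    unfolding Pr_def by (intro meromorphic_intros theta_mero)

  have zorder_Pr: "zorder Pr z = m z" for z
  proof -
    obtain b i j where b: "b \<in> period_cell t" "z = b + lattice_point t i j"
      using period_cell_representative[OF t] .
    have "zorder Pr z = (\<Sum>a\<in>R. zorder (\<lambda>x. theta t (x - a) powi m a) z)"
      unfolding Pr_def
    proof (rule zorder_prod)
      show "eventually (\<lambda>z. (\<Prod>a\<in>R. theta t (z - a) powi m a) \<noteq> 0) (at z)"
        using ev_S[of z] Pr_nz unfolding Pr_def by (auto elim: eventually_mono)
    qed (rule theta_mero)
    also have "\<dots> = (\<Sum>a\<in>R. if a = b then m b else 0)"
    proof (rule sum.cong)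
      fix a assume a: "a \<in> R"
      have "eventually (\<lambda>x. theta t (x - a) \<noteq> 0) (at z)"
        using ev_S[of z] by eventually_elim (use theta_nz a in blast)
      hence "zorder (\<lambda>x. theta t (x - a) powi m a) z = m a * zorder (\<lambda>x. theta t (x - a)) z"
        by (intro zorder_power_int analytic_on_imp_meromorphic_on theta_an)
           (auto intro: eventually_frequently)
      also have "zorder (\<lambda>x. theta t (x - a)) z = (if theta t (z - a) = 0 then 1 else 0)"
        by (simp add: zorder_translate zorder_theta[OF t])
      also have "theta t (z - a) = 0 \<longleftrightarrow> a = b"
      proof
        assume "theta t (z - a) = 0"
        then obtain i' j' where "z - a = lattice_point t i' j'"
          unfolding theta_eq_0_iff[OF t] lattice_point_def by blast
        hence "b = a + lattice_point t (i' - i) (j' - j)"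
          using b(2) by (simp add: lattice_point_def algebra_simps)
        thus "a = b"
          using period_cell_unique[OF t _ b(1)] a unfolding R_def by blast
      next
        assume "a = b"
        thus "theta t (z - a) = 0"
          unfolding theta_eq_0_iff[OF t] using b(2) by (auto simp: lattice_point_def)
      qed
      finally show "zorder (\<lambda>x. theta t (x - a) powi m a) z = (if a = b then m b else 0)"
        by simp
    qed simp
    also have "\<dots> = (if b \<in> R then m b else 0)"
      using fin by simp
    also have "\<dots> = m z"
      using b m_lattice[of b i j] by (auto simp: R_def)
    finally show ?thesis .
  qed

  define H0 where "H0 = (\<lambda>x. f x / Pr x)"
  define H where "H = remove_sings H0"
  have H0_mero: "H0 meromorphic_on A" for A
    unfolding H0_def
    by (intro meromorphic_intros Pr_mero meromorphic_on_subset[OF mero]) auto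
  have ev_nz: "eventually (\<lambda>w. f w \<noteq> 0) (at z)" "eventually (\<lambda>w. Pr w \<noteq> 0) (at z)"
              "eventually (\<lambda>w. H0 w \<noteq> 0) (at z)" for z
    using ev_S[of z] Pr_nz by (auto simp: S_def H0_def elim!: eventually_mono)
  have "zorder H0 z = 0" for z
  proof -
    have "zorder H0 z = zorder f z - zorder Pr z"
      unfolding H0_def
      by (intro zorder_divide Pr_mero meromorphic_on_subset[OF mero] eventually_frequently ev_nz) auto
    thus ?thesis
      by (simp add: zorder_Pr m_def)
  qed
  note H_props = remove_sings_nonvanishing[OF H0_mero this ev_nz(3), folded H_def]
  have H_holo: "H holomorphic_on UNIV"
    using H_props(1) analytic_on_analytic_at analytic_imp_holomorphic by blast
  have H_eq: "H x = H0 x" if "x \<in> S" for x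
  proof -
    have "Pr analytic_on {x}"
      unfolding Pr_def using theta_nz[OF that]
      by (intro analytic_on_prod analytic_on_power_int theta_an) auto
    hence "H0 analytic_on {x}"
      unfolding H0_def using that Pr_nz[OF that] by (intro analytic_on_divide) (auto simp: S_def)
    thus ?thesis
      unfolding H_def by (rule remove_sings_at_analytic)
  qed

  \<comment> \<open>\<open>H\<close> inherits a translation law from \<open>H0\<close> at every point, as a limit.\<close>
  have H_shift: "H (z + p) = exp (c + N * z) * H z"
    if "\<And>x. H0 (x + p) = exp (c + N * x) * H0 x" for z p c N
  proof (rule LIM_unique)
    show "(\<lambda>x. H0 (x + p)) \<midarrow>z\<rightarrow> H (z + p)"
      using LIM_offset[OF H_props(3)[of "z + p"], of p] by simp
    show "(\<lambda>x. H0 (x + p)) \<midarrow>z\<rightarrow> exp (c + N * z) * H z"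
      unfolding that by (intro tendsto_intros H_props(3))
  qed
  define c where "c = - (\<Sum>a\<in>R. of_int (m a) * (\<i> * of_real pi + 2 * \<i> * a))"
  define N where "N = - (\<Sum>a\<in>R. - 2 * \<i> * of_int (m a))"
  have H_per1: "H (x + of_real pi) = H x" for x
  proof -
    have "Pr (x + of_real pi) = Pr x" for x
      unfolding Pr_def using theta_plus_pi[OF t, of "x - _"] by (simp add: algebra_simps)
    hence "H0 (x + of_real pi) = exp (0 + 0 * x) * H0 x" for x
      by (simp add: H0_def per)
    from H_shift[OF this] show ?thesis by simp
  qed
  have H_per2: "H (x + of_real pi * t) = exp (c + N * x) * H x" for x
  proof (rule H_shift)
    fix x
    have "Pr (x + of_real pi * t) = exp (- (c + N * x)) * Pr x"
      unfolding Pr_def theta_product_quasi_periodic[OF t] c_def N_def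
      by (simp only: minus_add_distrib mult_minus_left minus_minus)
    thus "H0 (x + of_real pi * t) = exp (c + N * x) * H0 x"
      unfolding H0_def per exp_minus by (simp add: divide_inverse mult_ac)
  qed
  obtain k :: int where k: "\<And>x. H x = H 0 * exp (2 * \<i> * of_int k * x)"
    by (rule quasi_periodic_nonvanishing_exponential[OF t H_holo H_props(2) H_per1 H_per2]) blast

  have log_deriv_eq: "deriv f x / f x = of_int k * (2 * \<i>) +
           (\<Sum>a\<in>R. of_int (m a) * (deriv (theta t) (x - a) / theta t (x - a)))"
    if x: "x \<in> S" for x
  proof -
    define h where "h = (\<lambda>x. H 0 * exp (2 * \<i> * of_int k * x))"
    define L where "L = (\<Sum>a\<in>R. of_int (m a) * (deriv (theta t) (x - a) / theta t (x - a)))"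
    have f_eq: "f y = h y * Pr y" if "y \<in> S" for y
      using H_eq[OF that] k[of y] Pr_nz[OF that] by (simp add: H0_def h_def field_simps)
    have Pr': "(Pr has_field_derivative Pr x * L) (at x)"
      unfolding Pr_def L_def by (rule theta_product_derivative[OF t]) (use theta_nz[OF x] in auto)
    have "((\<lambda>y. h y * Pr y) has_field_derivative (of_int k * (2 * \<i>) + L) * (h x * Pr x)) (at x)"
      unfolding h_def by (rule derivative_eq_intros Pr' refl | simp add: algebra_simps)+
    hence "deriv (\<lambda>y. h y * Pr y) x = (of_int k * (2 * \<i>) + L) * (h x * Pr x)"
      by (rule DERIV_imp_deriv)
    moreover have "deriv f x = deriv (\<lambda>y. h y * Pr y) x"
    proof (rule deriv_cong_ev)
      have "eventually (\<lambda>y. f y = h y * Pr y) (at x)"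
        using ev_S[of x] by eventually_elim (rule f_eq)
      thus "eventually (\<lambda>y. f y = h y * Pr y) (nhds x)"
        using f_eq[OF x] by (simp add: eventually_nhds_conv_at)
    qed simp
    ultimately have "deriv f x = (of_int k * (2 * \<i>) + L) * f x"
      by (simp add: f_eq[OF x])
    thus ?thesis
      using x by (simp add: S_def L_def)
  qed

  have const: "factor_series_on S (\<lambda>_. of_int k * (2 * \<i>))"
  \<comment> \<open>For \<open>R\<close> empty the multiplier of \<open>H\<close> is \<open>1\<close>; otherwise any zero or pole serves to realize the constant.\<close>
  proof (cases "R = {}")
    case True
    hence "exp (2 * \<i> * (of_int k * (of_real pi * t))) = 1"
      using H_per2[of 0] k[of "of_real pi * t"] H_props(2)[of 0]
      by (simp add: c_def N_def mult_ac)
    then obtain j :: int where "of_int k * (of_real pi * t) = of_int j * of_real pi"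
      unfolding exp_2i_eq_1_iff by blast
    hence "Im (of_int k * (of_real pi * t)) = Im (of_int j * of_real pi)"
      by (rule arg_cong)
    hence "k = 0"
      using t by simp
    thus ?thesis
      using factor_series_on_0 by simp
  next
    case False
    then obtain a where a: "a \<in> R"
      by blast
    have "exp (2 * \<i> * (x - a)) \<noteq> 1" if "x \<in> S" for x
    proof
      assume "exp (2 * \<i> * (x - a)) = 1"
      then obtain j :: int where "x - a = of_int j * of_real pi + of_int 0 * (of_real pi * t)"
        unfolding exp_2i_eq_1_iff by auto
      thus False
        using theta_nz[OF that a] theta_eq_0_iff[OF t] by blast
    qed
    thus ?thesis
      by (intro factor_series_on_of_int_mult factor_series_on_const)
  qed
  have "factor_series_on S (\<lambda>x. of_int k * (2 * \<i>) +
           (\<Sum>a\<in>R. of_int (m a) * (deriv (theta t) (x - a) / theta t (x - a))))"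
    by (intro factor_series_on_add const factor_series_on_sum factor_series_on_of_int_mult
          factor_series_on_theta[OF t] theta_nz)
  thus ?thesis
    by (rule factor_series_on_cong[THEN iffD1, rotated]) (simp add: log_deriv_eq)
qed

text \<open>
  The substitution \<open>z = \<omega>1 x / \<pi>\<close> turns the periods \<open>\<omega>1\<close> and \<open>\<omega>2\<close> in \<open>z\<close> into the periods \<open>\<pi>\<close> and \<open>\<pi>t\<close> in \<open>x\<close>, where \<open>t = \<omega>2/\<omega>1\<close>.
\<close>

theorem theorem11p3:
  fixes \<tau> :: "complex \<Rightarrow> complex" and \<omega>1 \<omega>2 :: complex
  assumes "elliptic \<omega>1 \<omega>2 \<tau>"
  shows "\<exists>(\<epsilon> :: nat \<Rightarrow> real) (A :: block_diag) (B :: block_diag) (C :: block_diag) (E :: block_diag).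
           bd_periodic_linear_system \<epsilon> A B C E \<and>
           (\<forall>x. period_normalized \<omega>1 \<tau> analytic_on {x} \<and> period_normalized \<omega>1 \<tau> x \<noteq> 0 \<longrightarrow>
              bd_resolvent_invertible A E x \<and>
              bd_has_trace (bd_W A B C E x x) (log_deriv (period_normalized \<omega>1 \<tau>) x))"
proof -
  define f where "f = period_normalized \<omega>1 \<tau>"
  define t where "t = \<omega>2 / \<omega>1"
  have t: "Im t > 0" and mero: "\<tau> meromorphic_on UNIV"
    and per: "\<And>z. \<tau> (z + \<omega>1) = \<tau> z" "\<And>z. \<tau> (z + \<omega>2) = \<tau> z"
    using assms by (auto simp: elliptic_def t_def)
  have [simp]: "\<omega>1 \<noteq> 0"
    using t by (auto simp: t_def)
  have "f meromorphic_on UNIV"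
    unfolding f_def period_normalized_def
    by (rule meromorphic_on_compose[OF mero]) (auto intro!: analytic_intros)
  moreover have "f (x + of_real pi) = f x" "f (x + of_real pi * t) = f x" for x
  proof -
    have "\<omega>1 / of_real pi * (x + of_real pi) = \<omega>1 / of_real pi * x + \<omega>1"
         "\<omega>1 / of_real pi * (x + of_real pi * t) = \<omega>1 / of_real pi * x + \<omega>2"
      by (simp_all add: t_def field_simps)
    thus "f (x + of_real pi) = f x" "f (x + of_real pi * t) = f x"
      by (simp_all only: f_def period_normalized_def per)
  qed
  ultimately have "factor_series_on {x. f analytic_on {x} \<and> f x \<noteq> 0} (log_deriv f)"
    unfolding log_deriv_def by (rule doubly_periodic_log_deriv_factor_series[OF t])
  from bd_system_of_factor_series[OF this] show ?thesis
    unfolding f_def by simp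
qed

end
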